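(* Let $\mathbb{A}$ be a Nelson algebra. Then there exist a set $U$ and a quasiorder $R$ on $U$ such that $\mathbb{IRS}_R(U)$ is an effective lattice and $\mathbb{A}\cong\mathbb{IRS}_R(U)$ (as Nelson algebras) if and only if $\mathbb{A}$ is defined on an algebraic lattice in which each completely join-irreducible element is comparable with at least one completely join-irreducible element which is a fixed point of $g$.
   Context: A Kleene algebra $(A,\vee,\wedge,{\sim},0,1)$ is a bounded distributive lattice with a unary operation $\sim$ such that for all $a,b$: ${\sim}{\sim}a=a$; $a\le b$ iff ${\sim}b\le{\sim}a$; $a\wedge{\sim}a\le b\vee{\sim}b$. A Nelson algebra $(A,\vee,\wedge,\to,{\sim},0,1)$ is a Kleene algebra with a binary operation $\to$ such that for all $a,b,c$: $a\wedge c\le{\sim}a\vee b$ iff $c\le a\to b$; and $(a\wedge b)\to c=a\to(b\to c)$. An algebraic lattice is a complete lattice in which every element is a join of compact elements. An element $x$ of a complete lattice $L$ is completely join-irreducible if for every $X\subseteq L$, $x=\bigvee X$ implies $x\in X$; the set of these is denoted $\mathcal{J}$. If a Nelson algebra is defined on an algebraic lattice $(A,\le)$, then for $j\in\mathcal{J}$ one defines $g(j)=\bigwedge\{x\in A\mid x\nleq{\sim}j\}$; this is known to be an element of $\mathcal{J}$, so $g\colon\mathcal{J}\to\mathcal{J}$. A quasiorder on $U$ is a reflexive and transitive binary relation $R$ on $U$. Put $R(x)=\{y\in U\mid x\,R\,y\}$, $R(X)=\bigcup_{x\in X}R(x)$, and for $X\subseteq U$ let $X_R=\{x\in U\mid R(x)\subseteq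 X\}$, $X^R=\{x\in U\mid R(x)\cap X\neq\emptyset\}$, and $-X=U\setminus X$. Let $\mathit{IRS}_R(U)=\{(X_R,X^R)\mid X\subseteq U\}$. $\mathbb{IRS}_R(U)$ is the Nelson algebra on $\mathit{IRS}_R(U)$ (ordered by coordinatewise inclusion, with $0=(\emptyset,\emptyset)$ and $1=(U,U)$) with operations $(X_R,X^R)\vee(Y_R,Y^R)=(X_R\cup Y_R,X^R\cup Y^R)$, $(X_R,X^R)\wedge(Y_R,Y^R)=(X_R\cap Y_R,X^R\cap Y^R)$, ${\sim}(X_R,X^R)=(-X^R,-X_R)$, $(X_R,X^R)\to(Y_R,Y^R)=((-X_R\cup Y_R)_R,\,-X_R\cup Y^R)$. Let $\mathcal{T}_R(U)=\{X_R\mid X\subseteq U\}$, equivalently the family of all $R$-closed sets ($R(X)=X$). Under inclusion it is a Heyting algebra with $X\Rightarrow Y=(-X\cup Y)_R$. Let $S=\{x\in U\mid R(x)=\{x\}\}$ and let $\cong_S$ be the congruence on the Heyting algebra $\mathcal{T}_R(U)$ given by $X\cong_S Y$ iff $X\cap S=Y\cap S$. The Glivenko congruence $\Gamma$ of a Heyting algebra is $\{(a,b)\mid a^*=b^*\}$, where $a^*=a\Rightarrow 0$; it is the least congruence whose quotient is a Boolean algebra. One says that $\mathbb{IRS}_R(U)$ is an effective lattice if $\cong_S$ is the Glivenko congruence of $\mathcal{T}_R(U)$. *)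

theory Defs
  imports "HOL-Algebra.Complete_Lattice"
begin

section \<open>Nelson algebras\<close>

record 'a bdl = "'a partial_object" +
  vee  :: "'a \<Rightarrow> 'a \<Rightarrow> 'a"
  wedge :: "'a \<Rightarrow> 'a \<Rightarrow> 'a"
  zero :: 'a
  one  :: 'a

record 'a kleene = "'a bdl" +
  neg :: "'a \<Rightarrow> 'a"

record 'a nelson = "'a kleene" +
  arrow :: "'a \<Rightarrow> 'a \<Rightarrow> 'a"

record 'a heyting = "'a bdl" +
  himp :: "'a \<Rightarrow> 'a \<Rightarrow> 'a"

text \<open>The order of a lattice, packaged as an order record so that \<^locale>\<open>complete_lattice\<close>
  and the infinite joins and meets apply to it.\<close>

definition lat_order :: "('a, 'm) bdl_scheme \<Rightarrow> 'a gorder" where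
  "lat_order A = \<lparr>carrier = carrier A, eq = (=), le = (\<lambda>x y. wedge A x y = x)\<rparr>"

locale bounded_distributive_lattice =
  fixes A :: "('a, 'm) bdl_scheme"
  assumes vee_closed: "a \<in> carrier A \<Longrightarrow> b \<in> carrier A \<Longrightarrow> vee A a b \<in> carrier A"
    and wedge_closed: "a \<in> carrier A \<Longrightarrow> b \<in> carrier A \<Longrightarrow> wedge A a b \<in> carrier A"
    and zero_closed: "zero A \<in> carrier A"
    and one_closed: "one A \<in> carrier A"
    and vee_commute: "a \<in> carrier A \<Longrightarrow> b \<in> carrier A \<Longrightarrow> vee A a b = vee A b a"
    and wedge_commute: "a \<in> carrier A \<Longrightarrow> b \<in> carrier A \<Longrightarrow> wedge A a b = wedge A b a"
    and vee_assoc: "a \<in> carrier A \<Longrightarrow> b \<in> carrier A \<Longrightarrow> c \<in> carrier A \<Longrightarrow>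
      vee A (vee A a b) c = vee A a (vee A b c)"
    and wedge_assoc: "a \<in> carrier A \<Longrightarrow> b \<in> carrier A \<Longrightarrow> c \<in> carrier A \<Longrightarrow>
      wedge A (wedge A a b) c = wedge A a (wedge A b c)"
    and vee_absorb: "a \<in> carrier A \<Longrightarrow> b \<in> carrier A \<Longrightarrow> vee A a (wedge A a b) = a"
    and wedge_absorb: "a \<in> carrier A \<Longrightarrow> b \<in> carrier A \<Longrightarrow> wedge A a (vee A a b) = a"
    and distrib: "a \<in> carrier A \<Longrightarrow> b \<in> carrier A \<Longrightarrow> c \<in> carrier A \<Longrightarrow>
      wedge A a (vee A b c) = vee A (wedge A a b) (wedge A a c)"
    and vee_zero: "a \<in> carrier A \<Longrightarrow> vee A a (zero A) = a"
    and wedge_one: "a \<in> carrier A \<Longrightarrow> wedge A a (one A) = a"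

locale kleene_algebra = bounded_distributive_lattice A
  for A :: "('a, 'm) kleene_scheme" +
  assumes neg_closed: "a \<in> carrier A \<Longrightarrow> neg A a \<in> carrier A"
    and neg_neg: "a \<in> carrier A \<Longrightarrow> neg A (neg A a) = a"
    and neg_antitone: "a \<in> carrier A \<Longrightarrow> b \<in> carrier A \<Longrightarrow>
      a \<sqsubseteq>\<^bsub>lat_order A\<^esub> b \<longleftrightarrow> neg A b \<sqsubseteq>\<^bsub>lat_order A\<^esub> neg A a"
    and kleene: "a \<in> carrier A \<Longrightarrow> b \<in> carrier A \<Longrightarrow>
      wedge A a (neg A a) \<sqsubseteq>\<^bsub>lat_order A\<^esub> vee A b (neg A b)"

locale nelson_algebra = kleene_algebra A
  for A :: "('a, 'm) nelson_scheme" +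
  assumes arrow_closed: "a \<in> carrier A \<Longrightarrow> b \<in> carrier A \<Longrightarrow> arrow A a b \<in> carrier A"
    and arrow_residual: "a \<in> carrier A \<Longrightarrow> b \<in> carrier A \<Longrightarrow> c \<in> carrier A \<Longrightarrow>
      wedge A a c \<sqsubseteq>\<^bsub>lat_order A\<^esub> vee A (neg A a) b \<longleftrightarrow> c \<sqsubseteq>\<^bsub>lat_order A\<^esub> arrow A a b"
    and arrow_curry: "a \<in> carrier A \<Longrightarrow> b \<in> carrier A \<Longrightarrow> c \<in> carrier A \<Longrightarrow>
      arrow A (wedge A a b) c = arrow A a (arrow A b c)"

definition nelson_iso :: "('a, 'm) nelson_scheme \<Rightarrow> ('b, 'n) nelson_scheme \<Rightarrow> ('a \<Rightarrow> 'b) \<Rightarrow> bool" where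
  "nelson_iso A B f \<longleftrightarrow>
     bij_betw f (carrier A) (carrier B) \<and>
     (\<forall>a\<in>carrier A. \<forall>b\<in>carrier A.
        f (vee A a b) = vee B (f a) (f b) \<and>
        f (wedge A a b) = wedge B (f a) (f b) \<and>
        f (arrow A a b) = arrow B (f a) (f b)) \<and>
     (\<forall>a\<in>carrier A. f (neg A a) = neg B (f a)) \<and>
     f (zero A) = zero B \<and> f (one A) = one B"

definition nelson_isomorphic :: "('a, 'm) nelson_scheme \<Rightarrow> ('b, 'n) nelson_scheme \<Rightarrow> bool" where
  "nelson_isomorphic A B \<longleftrightarrow> (\<exists>f. nelson_iso A B f)"


section \<open>Algebraic lattices and completely join-irreducible elements\<close>

definition compact_elements :: "('a, 'm) gorder_scheme \<Rightarrow> 'a set" where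
  "compact_elements L = {c \<in> carrier L. \<forall>X \<subseteq> carrier L. c \<sqsubseteq>\<^bsub>L\<^esub> \<Squnion>\<^bsub>L\<^esub>X \<longrightarrow>
     (\<exists>F. finite F \<and> F \<subseteq> X \<and> c \<sqsubseteq>\<^bsub>L\<^esub> \<Squnion>\<^bsub>L\<^esub>F)}"

definition algebraic_lattice :: "('a, 'm) gorder_scheme \<Rightarrow> bool" where
  "algebraic_lattice L \<longleftrightarrow> complete_lattice L \<and>
     (\<forall>x \<in> carrier L. \<exists>C \<subseteq> compact_elements L. x = \<Squnion>\<^bsub>L\<^esub>C)"

text \<open>The case \<open>X = {}\<close> is included, so the least element is not completely join-irreducible.\<close>

definition comp_join_irr :: "('a, 'm) gorder_scheme \<Rightarrow> 'a set" where
  "comp_join_irr L = {x \<in> carrier L. \<forall>X \<subseteq> carrier L. x = \<Squnion>\<^bsub>L\<^esub>X \<longrightarrow> x \<in> X}"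

text \<open>Only meaningful when the underlying lattice is complete.\<close>

definition g_map :: "('a, 'm) kleene_scheme \<Rightarrow> 'a \<Rightarrow> 'a" where
  "g_map A j = \<Sqinter>\<^bsub>lat_order A\<^esub> {x \<in> carrier A. \<not> x \<sqsubseteq>\<^bsub>lat_order A\<^esub> neg A j}"


section \<open>Rough sets determined by a quasiorder\<close>

definition lower_approx :: "'u set \<Rightarrow> 'u rel \<Rightarrow> 'u set \<Rightarrow> 'u set" where
  "lower_approx U R X = {x \<in> U. R `` {x} \<subseteq> X}"

definition upper_approx :: "'u set \<Rightarrow> 'u rel \<Rightarrow> 'u set \<Rightarrow> 'u set" where
  "upper_approx U R X = {x \<in> U. R `` {x} \<inter> X \<noteq> {}}"

definition IRS :: "'u set \<Rightarrow> 'u rel \<Rightarrow> ('u set \<times> 'u set) nelson" where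
  "IRS U R =
    \<lparr>carrier = {(lower_approx U R X, upper_approx U R X) | X. X \<subseteq> U},
     vee = (\<lambda>(A, B) (C, D). (A \<union> C, B \<union> D)),
     wedge = (\<lambda>(A, B) (C, D). (A \<inter> C, B \<inter> D)),
     zero = ({}, {}),
     one = (U, U),
     neg = (\<lambda>(A, B). (U - B, U - A)),
     arrow = (\<lambda>(A, B) (C, D). (lower_approx U R ((U - A) \<union> C), (U - A) \<union> D))\<rparr>"

definition closed_sets :: "'u set \<Rightarrow> 'u rel \<Rightarrow> 'u set heyting" where
  "closed_sets U R =
    \<lparr>carrier = {lower_approx U R X | X. X \<subseteq> U},
     vee = (\<union>), wedge = (\<inter>), zero = {}, one = U,
     himp = (\<lambda>X Y. lower_approx U R ((U - X) \<union> Y))\<rparr>"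

definition glivenko_congruence :: "('a, 'm) heyting_scheme \<Rightarrow> 'a rel" where
  "glivenko_congruence H =
     {(a, b). a \<in> carrier H \<and> b \<in> carrier H \<and> himp H a (zero H) = himp H b (zero H)}"

definition singleton_points :: "'u set \<Rightarrow> 'u rel \<Rightarrow> 'u set" where
  "singleton_points U R = {x \<in> U. R `` {x} = {x}}"

definition cong_S :: "'u set \<Rightarrow> 'u rel \<Rightarrow> 'u set rel" where
  "cong_S U R =
     {(X, Y). X \<in> carrier (closed_sets U R) \<and> Y \<in> carrier (closed_sets U R) \<and>
        X \<inter> singleton_points U R = Y \<inter> singleton_points U R}"

definition effective_IRS :: "'u set \<Rightarrow> 'u rel \<Rightarrow> bool" where
  "effective_IRS U R \<longleftrightarrow> cong_S U R = glivenko_congruence (closed_sets U R)"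

end

theory Submission
  imports Defs
begin

text \<open>
  If every point of \<open>U\<close> sees a point of \<open>S\<close>, which is what effectiveness means, then the rough
  sets are exactly the pairs \<open>(P, Q)\<close> with \<open>P \<subseteq> Q\<close>, \<open>P\<close> closed upwards, \<open>Q\<close> closed downwards and
  \<open>S \<inter> Q \<subseteq> P\<close>. Such pairs are closed under coordinatewise unions and intersections, they are
  generated by the completely prime elements \<open>({}, {x}\<^sup>R)\<close> (\<open>x \<notin> S\<close>) and \<open>(R(x), R(x)\<^sup>R)\<close>, and
  \<open>(R(s), R(s)\<^sup>R)\<close> is fixed by \<open>g\<close> for \<open>s \<in> S\<close>.

  Conversely, in a Nelson algebra on an algebraic lattice the completely join-irreducible elements
  are completely join-prime and separate points, and \<open>g\<close> is an antitone involution on them with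
  \<open>x\<close> and \<open>g x\<close> comparable. Take \<open>U = J\<close> and let \<open>x R y\<close> mean \<open>min x (g x) \<le> min y (g y)\<close>; then
  \<open>S\<close> is the set of fixed points of \<open>g\<close>, and \<open>a\<close> is sent to the rough set of \<open>{j \<in> J. j \<le> a}\<close>.
  Surjectivity and compatibility with \<open>\<rightarrow>\<close> rest on the interpolation property of \<open>g\<close>.
\<close>

section \<open>Order and lattice operations\<close>

lemma carrier_lat_order [simp]: "carrier (lat_order A) = carrier A"
  by (simp add: lat_order_def)

lemma le_lat_order: "x \<sqsubseteq>\<^bsub>lat_order A\<^esub> y \<longleftrightarrow> wedge A x y = x"
  by (simp add: lat_order_def)

context bounded_distributive_lattice
begin

abbreviation leq (infix "\<preceq>" 50) where "x \<preceq> y \<equiv> x \<sqsubseteq>\<^bsub>lat_order A\<^esub> y"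

lemma wedge_idem: "a \<in> carrier A \<Longrightarrow> wedge A a a = a"
  by (metis vee_absorb wedge_absorb wedge_closed)

lemma partial_order_lat_order: "partial_order (lat_order A)"
proof (unfold_locales, simp_all add: le_lat_order wedge_idem)
  show "(.=\<^bsub>lat_order A\<^esub>) = (=)"
    by (simp add: lat_order_def)
qed (simp_all add: lat_order_def, (metis wedge_commute wedge_assoc)+)

end

sublocale bounded_distributive_lattice \<subseteq> partial_order "lat_order A"
  by (rule partial_order_lat_order)

context bounded_distributive_lattice
begin

lemma le_trans': "x \<preceq> y \<Longrightarrow> y \<preceq> z \<Longrightarrow> x \<in> carrier A \<Longrightarrow> y \<in> carrier A \<Longrightarrow> z \<in> carrier A \<Longrightarrow> x \<preceq> z"
  using le_trans by simp

lemma le_antisym': "x \<preceq> y \<Longrightarrow> y \<preceq> x \<Longrightarrow> x \<in> carrier A \<Longrightarrow> y \<in> carrier A \<Longrightarrow> x = y"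
  using le_antisym by simp

lemma wedge_le1: "a \<in> carrier A \<Longrightarrow> b \<in> carrier A \<Longrightarrow> wedge A a b \<preceq> a"
  unfolding le_lat_order by (metis wedge_assoc wedge_commute wedge_idem)

lemma wedge_le2: "a \<in> carrier A \<Longrightarrow> b \<in> carrier A \<Longrightarrow> wedge A a b \<preceq> b"
  using wedge_le1 wedge_commute by metis

lemma le_wedge_iff:
  assumes "a \<in> carrier A" "b \<in> carrier A" "c \<in> carrier A"
  shows "c \<preceq> wedge A a b \<longleftrightarrow> c \<preceq> a \<and> c \<preceq> b"
proof
  show "c \<preceq> a \<and> c \<preceq> b" if "c \<preceq> wedge A a b"
    using that assms le_trans' wedge_closed wedge_le1 wedge_le2 by meson
  show "c \<preceq> wedge A a b" if "c \<preceq> a \<and> c \<preceq> b"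
    using that assms unfolding le_lat_order by (metis wedge_assoc)
qed

lemma wedge_mono1:
  assumes "a \<preceq> b" "a \<in> carrier A" "b \<in> carrier A" "c \<in> carrier A"
  shows "wedge A a c \<preceq> wedge A b c"
  using assms le_trans'[OF wedge_le1[of a c] assms(1)] by (simp add: le_wedge_iff wedge_closed wedge_le2)

lemma le_vee1: "a \<in> carrier A \<Longrightarrow> b \<in> carrier A \<Longrightarrow> a \<preceq> vee A a b"
  by (simp add: le_lat_order wedge_absorb)

lemma le_vee2: "a \<in> carrier A \<Longrightarrow> b \<in> carrier A \<Longrightarrow> b \<preceq> vee A a b"
  using le_vee1 vee_commute by metis

lemma le_iff_vee: "a \<in> carrier A \<Longrightarrow> b \<in> carrier A \<Longrightarrow> a \<preceq> b \<longleftrightarrow> vee A a b = b"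
  unfolding le_lat_order by (metis vee_absorb vee_commute wedge_absorb wedge_commute)

lemma vee_le_iff:
  assumes "a \<in> carrier A" "b \<in> carrier A" "c \<in> carrier A"
  shows "vee A a b \<preceq> c \<longleftrightarrow> a \<preceq> c \<and> b \<preceq> c"
proof
  show "a \<preceq> c \<and> b \<preceq> c" if "vee A a b \<preceq> c"
    using that assms le_trans' vee_closed le_vee1 le_vee2 by meson
  show "vee A a b \<preceq> c" if "a \<preceq> c \<and> b \<preceq> c"
    using that assms by (simp add: le_iff_vee vee_closed vee_assoc)
qed

lemma zero_le: "a \<in> carrier A \<Longrightarrow> zero A \<preceq> a"
  by (metis le_iff_vee vee_commute vee_zero zero_closed)

lemma le_one: "a \<in> carrier A \<Longrightarrow> a \<preceq> one A"
  by (simp add: le_lat_order wedge_one)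

end


section \<open>Nelson algebras on algebraic lattices\<close>

locale algebraic_nelson_algebra = nelson_algebra A for A :: "('a, 'm) nelson_scheme" +
  assumes algebraic: "algebraic_lattice (lat_order A)"

sublocale algebraic_nelson_algebra \<subseteq> complete_lattice "lat_order A"
  using algebraic by (simp add: algebraic_lattice_def)

context algebraic_nelson_algebra
begin

section \<open>Completely join-irreducible elements: complete primeness and separation of
  points\<close>

abbreviation J where "J \<equiv> comp_join_irr (lat_order A)"

lemma J_closed: "j \<in> J \<Longrightarrow> j \<in> carrier A"
  by (simp add: comp_join_irr_def)

lemma Sup_closed: "X \<subseteq> carrier A \<Longrightarrow> \<Squnion>\<^bsub>lat_order A\<^esub>X \<in> carrier A"
  using sup_closed[of X] by simp

lemma Inf_closed: "X \<subseteq> carrier A \<Longrightarrow> \<Sqinter>\<^bsub>lat_order A\<^esub>X \<in> carrier A"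
  using inf_closed[of X] by simp

lemma le_Sup: "X \<subseteq> carrier A \<Longrightarrow> x \<in> X \<Longrightarrow> x \<preceq> \<Squnion>\<^bsub>lat_order A\<^esub>X"
  using sup_upper[of X x] by simp

lemma Sup_le: "X \<subseteq> carrier A \<Longrightarrow> z \<in> carrier A \<Longrightarrow> (\<And>x. x \<in> X \<Longrightarrow> x \<preceq> z) \<Longrightarrow> \<Squnion>\<^bsub>lat_order A\<^esub>X \<preceq> z"
  using sup_least[of X z] by simp

lemma compact_elementsD:
  assumes "c \<in> compact_elements (lat_order A)" "X \<subseteq> carrier A" "c \<preceq> \<Squnion>\<^bsub>lat_order A\<^esub>X"
  obtains F where "finite F" "F \<subseteq> X" "c \<preceq> \<Squnion>\<^bsub>lat_order A\<^esub>F"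
  using assms by (auto simp: compact_elements_def)

text \<open>Finite joins are handled by induction from \<open>distrib\<close>; compactness then
  gives access to arbitrary joins in \<open>J_prime\<close>.\<close>

lemma wedge_finite_Sup_le:
  assumes "finite F" "F \<subseteq> carrier A" "a \<in> carrier A" "u \<in> carrier A"
    and "\<And>x. x \<in> F \<Longrightarrow> wedge A a x \<preceq> u"
  shows "wedge A a (\<Squnion>\<^bsub>lat_order A\<^esub>F) \<preceq> u"
  using assms
proof (induction F)
  case empty
  have "\<Squnion>\<^bsub>lat_order A\<^esub>{} \<preceq> u"
    using empty Sup_le by auto
  moreover have "wedge A a (\<Squnion>\<^bsub>lat_order A\<^esub>{}) \<preceq> \<Squnion>\<^bsub>lat_order A\<^esub>{}"
    using empty Sup_closed wedge_le2 by blast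
  ultimately show ?case
    using empty Sup_closed wedge_closed le_trans' by (meson empty_subsetI)
next
  case (insert x F)
  let ?s = "\<Squnion>\<^bsub>lat_order A\<^esub>F"
  let ?t = "\<Squnion>\<^bsub>lat_order A\<^esub>(insert x F)"
  have cl: "x \<in> carrier A" "?s \<in> carrier A" "?t \<in> carrier A"
    using insert.prems Sup_closed by auto
  have "?t \<preceq> vee A x ?s"
  proof (rule Sup_le)
    fix y assume "y \<in> insert x F"
    then consider "y = x" | "y \<in> F" "y \<in> carrier A" using insert.prems by blast
    then show "y \<preceq> vee A x ?s"
    proof cases
      case 1
      then show ?thesis using cl le_vee1 by simp
    next
      case 2
      then show ?thesis
        using insert.prems cl le_trans'[OF le_Sup[of F y] le_vee2[of x ?s]] vee_closed by simp
    qed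
  qed (use insert.prems cl vee_closed in auto)
  then have "wedge A a ?t \<preceq> wedge A a (vee A x ?s)"
    using insert.prems cl wedge_mono1[of ?t "vee A x ?s" a] vee_closed wedge_commute by simp
  moreover have "wedge A a (vee A x ?s) \<preceq> u"
    using insert cl by (simp add: distrib vee_le_iff wedge_closed)
  ultimately show ?case
    using insert.prems cl vee_closed wedge_closed le_trans'[of "wedge A a ?t" "wedge A a (vee A x ?s)" u] by blast
qed

text \<open>Algebraicity replaces infinite distributivity. A compact \<open>c\<close> below
  \<open>j\<close> lies below a finite join of members of \<open>X\<close>, hence below the join of
  the elements \<open>wedge A j x\<close>. So \<open>j\<close> equals that join, and irreducibility
  makes it one of them.\<close>

lemma J_prime:
  assumes j: "j \<in> J" and X: "X \<subseteq> carrier A" and le: "j \<preceq> \<Squnion>\<^bsub>lat_order A\<^esub>X"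
  shows "\<exists>x\<in>X. j \<preceq> x"
proof -
  let ?Y = "wedge A j ` X"
  have jc: "j \<in> carrier A" using j J_closed by blast
  have Y: "?Y \<subseteq> carrier A" using X jc wedge_closed by auto
  obtain C where C: "C \<subseteq> compact_elements (lat_order A)" "j = \<Squnion>\<^bsub>lat_order A\<^esub>C"
    using algebraic jc unfolding algebraic_lattice_def by auto
  have Cc: "C \<subseteq> carrier A" using C(1) by (auto simp: compact_elements_def)
  have "c \<preceq> \<Squnion>\<^bsub>lat_order A\<^esub>?Y" if c: "c \<in> C" for c
  proof -
    have cc: "c \<in> carrier A" and cj: "c \<preceq> j"
      using c Cc C(2) le_Sup by auto
    have "c \<preceq> \<Squnion>\<^bsub>lat_order A\<^esub>X"
      using le_trans'[OF cj le] cc jc X Sup_closed by blast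
    then obtain F where F: "finite F" "F \<subseteq> X" "c \<preceq> \<Squnion>\<^bsub>lat_order A\<^esub>F"
      using compact_elementsD[OF subsetD[OF C(1) c] X] by metis
    have "wedge A c x \<preceq> \<Squnion>\<^bsub>lat_order A\<^esub>?Y" if "x \<in> F" for x
    proof -
      have x: "x \<in> X" "x \<in> carrier A" using that F X by auto
      have "wedge A c x \<preceq> wedge A j x"
        using x cc jc cj wedge_mono1 by blast
      moreover have "wedge A j x \<preceq> \<Squnion>\<^bsub>lat_order A\<^esub>?Y"
        using le_Sup[OF Y] x by blast
      ultimately show ?thesis
        using x cc jc wedge_closed Sup_closed[OF Y] le_trans' by meson
    qed
    then have "wedge A c (\<Squnion>\<^bsub>lat_order A\<^esub>F) \<preceq> \<Squnion>\<^bsub>lat_order A\<^esub>?Y"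
      using wedge_finite_Sup_le F X cc Sup_closed[OF Y] by auto
    then show ?thesis
      using F(3) by (simp add: le_lat_order)
  qed
  then have "j \<preceq> \<Squnion>\<^bsub>lat_order A\<^esub>?Y"
    using C(2) Cc Sup_le Sup_closed[OF Y] by auto
  moreover have "\<Squnion>\<^bsub>lat_order A\<^esub>?Y \<preceq> j"
    using Y jc X wedge_le1 by (intro Sup_le) auto
  ultimately have "j = \<Squnion>\<^bsub>lat_order A\<^esub>?Y"
    using le_antisym' jc Sup_closed[OF Y] by blast
  then have "j \<in> ?Y"
    using j Y unfolding comp_join_irr_def by auto
  then obtain x where "x \<in> X" "j = wedge A j x" by blast
  then show ?thesis
    using X jc wedge_le2[of j x] by auto
qed

lemma J_vee_iff:
  assumes "j \<in> J" "a \<in> carrier A" "b \<in> carrier A"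
  shows "j \<preceq> vee A a b \<longleftrightarrow> j \<preceq> a \<or> j \<preceq> b"
proof
  assume "j \<preceq> vee A a b"
  moreover have "vee A a b \<preceq> \<Squnion>\<^bsub>lat_order A\<^esub>{a, b}"
    using assms le_Sup[of "{a, b}"] Sup_closed[of "{a, b}"] by (simp add: vee_le_iff)
  ultimately have "j \<preceq> \<Squnion>\<^bsub>lat_order A\<^esub>{a, b}"
    using assms J_closed vee_closed Sup_closed[of "{a, b}"] le_trans' by (meson empty_subsetI insert_subset)
  then show "j \<preceq> a \<or> j \<preceq> b"
    using J_prime[of j "{a, b}"] assms by auto
next
  show "j \<preceq> a \<or> j \<preceq> b \<Longrightarrow> j \<preceq> vee A a b"
    using assms J_closed vee_closed le_vee1 le_vee2 le_trans' by meson
qed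

lemma J_not_le_zero: "j \<in> J \<Longrightarrow> \<not> j \<preceq> zero A"
  using J_prime[of j "{}"] Sup_closed[of "{}"] zero_le zero_closed J_closed le_trans' 
  by (metis empty_iff empty_subsetI)

lemma neg_le_iff: "a \<in> carrier A \<Longrightarrow> b \<in> carrier A \<Longrightarrow> neg A a \<preceq> b \<longleftrightarrow> neg A b \<preceq> a"
  using neg_antitone neg_closed neg_neg by metis

lemma le_neg_iff: "a \<in> carrier A \<Longrightarrow> b \<in> carrier A \<Longrightarrow> a \<preceq> neg A b \<longleftrightarrow> b \<preceq> neg A a"
  using neg_antitone neg_closed neg_neg by metis

text \<open>Serves the Zorn argument: a finite subset of a chain, supplied by compactness, is
  dominated by one of its members.\<close>

lemma finite_chain_has_greatest:
  assumes "finite F" "F \<noteq> {}" "F \<subseteq> carrier A" "\<And>x y. x \<in> F \<Longrightarrow> y \<in> F \<Longrightarrow> x \<preceq> y \<or> y \<preceq> x"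
  shows "\<exists>m\<in>F. \<forall>x\<in>F. x \<preceq> m"
  using assms
proof (induction F rule: finite_ne_induct)
  case (singleton x)
  then show ?case by simp
next
  case (insert x F)
  then obtain m where m: "m \<in> F" "\<forall>y\<in>F. y \<preceq> m" by auto
  then consider "x \<preceq> m" | "m \<preceq> x"
    using insert.prems by blast
  then show ?case
  proof cases
    case 1
    then show ?thesis using m by auto
  next
    case 2
    then have "\<forall>y\<in>F. y \<preceq> x"
      using m insert.prems le_trans' by (meson insert_subset subsetD)
    then show ?thesis using insert.prems by auto
  qed
qed

text \<open>An element maximal among those not above a compact \<open>c\<close> is completely meet-irreducible,
  so its negation is completely join-irreducible.\<close>

lemma J_separates:
  assumes a: "a \<in> carrier A" and b: "b \<in> carrier A" and nle: "\<not> a \<preceq> b"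
  shows "\<exists>j\<in>J. j \<preceq> a \<and> \<not> j \<preceq> b"
proof -
  \<comment> \<open>Compactness is used on the negated side: the \<open>c\<close> that
    \<open>M\<close> avoids is compact, below \<open>neg A b\<close> and not below
    \<open>neg A a\<close>.\<close>
  obtain C where C: "C \<subseteq> compact_elements (lat_order A)" "neg A b = \<Squnion>\<^bsub>lat_order A\<^esub>C"
    using algebraic neg_closed[OF b] unfolding algebraic_lattice_def by auto
  have Cc: "C \<subseteq> carrier A" using C(1) by (auto simp: compact_elements_def)
  have "\<not> neg A b \<preceq> neg A a"
    using nle neg_antitone[OF a b] by simp
  then obtain c where c: "c \<in> C" "\<not> c \<preceq> neg A a"
    using C(2) Cc Sup_le neg_closed[OF a] by metis
  have cc: "c \<in> carrier A" and cb: "c \<preceq> neg A b"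
    using c Cc C(2) le_Sup by auto
  define M where "M = {m \<in> carrier A. neg A a \<preceq> m \<and> \<not> c \<preceq> m}"
  have Mc: "M \<subseteq> carrier A" by (auto simp: M_def)
  have na: "neg A a \<in> M"
    using a c neg_closed by (auto simp: M_def)
  have "\<exists>m\<in>M. \<forall>x\<in>M. m \<preceq> x \<longrightarrow> x = m"
  proof (rule predicate_Zorn)
    show "partial_order_on M (relation_of (\<preceq>) M)"
      using Mc by (intro partial_order_on_relation_ofI) (auto intro: le_trans' le_antisym')
    fix D assume D: "D \<in> Chains (relation_of (\<preceq>) M)"
    then have DM: "D \<subseteq> M" and tot: "\<And>x y. x \<in> D \<Longrightarrow> y \<in> D \<Longrightarrow> x \<preceq> y \<or> y \<preceq> x"
      unfolding Chains_def relation_of_def by blast+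
    have Dc: "D \<subseteq> carrier A" using DM Mc by blast
    show "\<exists>u\<in>M. \<forall>x\<in>D. x \<preceq> u"
    proof (cases "D = {}")
      case True
      then show ?thesis using na by blast
    next
      case False
      then obtain d where d: "d \<in> D" by blast
      \<comment> \<open>The join of a nonempty chain in \<open>M\<close> stays in \<open>M\<close>:
        otherwise compactness would put \<open>c\<close> below a finite join of members, hence below
        one member.\<close>
      have "\<not> c \<preceq> \<Squnion>\<^bsub>lat_order A\<^esub>D"
      proof
        assume "c \<preceq> \<Squnion>\<^bsub>lat_order A\<^esub>D"
        then obtain F where F: "finite F" "F \<subseteq> D" "c \<preceq> \<Squnion>\<^bsub>lat_order A\<^esub>F"
          using compact_elementsD[OF subsetD[OF C(1) c(1)] Dc] by metis
        have "\<exists>m\<in>D. \<forall>x\<in>F. x \<preceq> m"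
        proof (cases "F = {}")
          case False
          then obtain m where "m \<in> F" "\<forall>x\<in>F. x \<preceq> m"
            using finite_chain_has_greatest[OF F(1) False order_trans[OF F(2) Dc]] tot subsetD[OF F(2)]
            by metis
          then show ?thesis using F(2) by blast
        qed (use d in auto)
        then obtain m where m: "m \<in> D" "\<forall>x\<in>F. x \<preceq> m" by blast
        then have "\<Squnion>\<^bsub>lat_order A\<^esub>F \<preceq> m"
          using F Dc by (intro Sup_le) auto
        then have "c \<preceq> m"
          using le_trans'[OF F(3)] cc m(1) Dc Sup_closed[of F] F(2) by (meson order_trans subsetD)
        then show False using m DM by (auto simp: M_def)
      qed
      moreover have "neg A a \<preceq> \<Squnion>\<^bsub>lat_order A\<^esub>D"
        using d DM Dc le_trans'[OF _ le_Sup[OF Dc d]] Sup_closed[OF Dc] neg_closed[OF a]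
        by (auto simp: M_def)
      ultimately show ?thesis
        using Sup_closed[OF Dc] le_Sup[OF Dc] by (auto simp: M_def)
    qed
  qed
  then obtain m where m: "m \<in> M" and max: "\<And>x. x \<in> M \<Longrightarrow> m \<preceq> x \<Longrightarrow> x = m" by blast
  have mc: "m \<in> carrier A" and am: "neg A a \<preceq> m" and cm: "\<not> c \<preceq> m"
    using m by (auto simp: M_def)
  have "neg A m \<in> J"
    unfolding comp_join_irr_def
  proof (clarsimp simp: neg_closed[OF mc])
    fix X assume X: "X \<subseteq> carrier A" and eq: "neg A m = \<Squnion>\<^bsub>lat_order A\<^esub>X"
    show "\<Squnion>\<^bsub>lat_order A\<^esub>X \<in> X"
    proof (rule ccontr)
      assume n: "\<Squnion>\<^bsub>lat_order A\<^esub>X \<notin> X"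
      \<comment> \<open>Since \<open>x\<close> differs from the join \<open>neg A m\<close>, its
        negation lies strictly above \<open>m\<close>; maximality expels it from \<open>M\<close>,
        so it is above \<open>c\<close>.\<close>
      have "x \<preceq> neg A c" if x: "x \<in> X" for x
      proof -
        have xc: "x \<in> carrier A" using x X by blast
        have "x \<preceq> neg A m" using le_Sup[OF X x] eq by simp
        then have "m \<preceq> neg A x" using le_neg_iff xc mc by blast
        moreover have "neg A x \<noteq> m"
          using x n eq neg_neg[OF xc] by auto
        ultimately have "neg A x \<notin> M" using max by blast
        moreover have "neg A a \<preceq> neg A x"
          using am \<open>m \<preceq> neg A x\<close> a xc mc neg_closed le_trans' by meson
        ultimately have "c \<preceq> neg A x"
          using neg_closed[OF xc] by (auto simp: M_def)
        then show ?thesis using le_neg_iff xc cc by blast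
      qed
      then have "neg A m \<preceq> neg A c"
        using eq Sup_le[OF X] neg_closed[OF cc] by simp
      then show False using cm neg_antitone[OF cc mc] by simp
    qed
  qed
  moreover have "neg A m \<preceq> a"
    using am neg_le_iff a mc by blast
  moreover have "\<not> neg A m \<preceq> b"
    using cm cb b mc cc neg_le_iff neg_closed le_trans' by meson
  ultimately show ?thesis by blast
qed

text \<open>Join-density of \<open>J\<close>: later inequalities are tested on
  \<open>J\<close>.\<close>

lemma le_iff_J:
  assumes "a \<in> carrier A" "b \<in> carrier A"
  shows "a \<preceq> b \<longleftrightarrow> (\<forall>j\<in>J. j \<preceq> a \<longrightarrow> j \<preceq> b)"
  using assms J_separates J_closed le_trans' by meson

section \<open>The map \<open>g\<close> on \<open>J\<close>\<close>

abbreviation g where "g \<equiv> g_map A"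

lemma g_carrier: "j \<in> carrier A \<Longrightarrow> g j \<in> carrier A"
  unfolding g_map_def by (rule Inf_closed) auto

text \<open>Complete primeness of \<open>j\<close>, carried through negation, says that a meet lies
  below \<open>neg A j\<close> only if one of its terms does. Hence the elements not below
  \<open>neg A j\<close> form the principal filter of \<open>g j\<close>.\<close>

lemma g_le_iff:
  assumes j: "j \<in> J" and x: "x \<in> carrier A"
  shows "g j \<preceq> x \<longleftrightarrow> \<not> x \<preceq> neg A j"
proof
  let ?P = "{x \<in> carrier A. \<not> x \<preceq> neg A j}"
  have P: "?P \<subseteq> carrier A" by auto
  have jc: "j \<in> carrier A" using j J_closed by blast
  have gj: "g j = \<Sqinter>\<^bsub>lat_order A\<^esub>?P" by (simp add: g_map_def)
  assume "\<not> x \<preceq> neg A j"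
  then show "g j \<preceq> x"
    unfolding gj using inf_lower[of ?P x] P x by simp
next
  let ?P = "{x \<in> carrier A. \<not> x \<preceq> neg A j}"
  have P: "?P \<subseteq> carrier A" by auto
  have jc: "j \<in> carrier A" using j J_closed by blast
  have gj: "g j = \<Sqinter>\<^bsub>lat_order A\<^esub>?P" by (simp add: g_map_def)
  assume gx: "g j \<preceq> x"
  show "\<not> x \<preceq> neg A j"
  proof
    assume "x \<preceq> neg A j"
    then have "g j \<preceq> neg A j"
      using gx x jc g_carrier neg_closed le_trans' by meson
    then have le: "j \<preceq> neg A (g j)"
      using jc g_carrier le_neg_iff by blast
    \<comment> \<open>Negating the family turns the meet \<open>g j\<close> into a join, to which
      \<open>J_prime\<close> applies.\<close>
    let ?N = "neg A ` ?P"
    have N: "?N \<subseteq> carrier A" using neg_closed by auto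
    have "neg A (\<Squnion>\<^bsub>lat_order A\<^esub>?N) \<preceq> g j"
      unfolding gj
    proof (rule inf_greatest)
      fix y assume y: "y \<in> ?P"
      then have "neg A y \<preceq> \<Squnion>\<^bsub>lat_order A\<^esub>?N" using le_Sup[OF N] by blast
      then show "neg A (\<Squnion>\<^bsub>lat_order A\<^esub>?N) \<preceq> y"
        using y Sup_closed[OF N] neg_le_iff by blast
    qed (use Sup_closed[OF N] neg_closed in auto)
    then have "neg A (g j) \<preceq> \<Squnion>\<^bsub>lat_order A\<^esub>?N"
      using Sup_closed[OF N] jc g_carrier neg_le_iff by blast
    then have "j \<preceq> \<Squnion>\<^bsub>lat_order A\<^esub>?N"
      using le jc g_carrier neg_closed Sup_closed[OF N] le_trans' by meson
    then obtain y where "y \<in> ?P" "j \<preceq> neg A y"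
      using J_prime[OF j N] by blast
    then show False
      using jc le_neg_iff by blast
  qed
qed

text \<open>If no member of \<open>X\<close> were above \<open>g j\<close>, \<open>g_le_iff\<close>
  would put all of them, and so their join \<open>g j\<close>, below \<open>neg A j\<close>;
  \<open>g_le_iff\<close> at \<open>g j\<close> itself forbids this.\<close>

lemma g_J:
  assumes j: "j \<in> J"
  shows "g j \<in> J"
  unfolding comp_join_irr_def
proof (clarsimp simp: g_carrier[OF J_closed[OF j]])
  fix X assume X: "X \<subseteq> carrier A" and eq: "g j = \<Squnion>\<^bsub>lat_order A\<^esub>X"
  have gc: "g j \<in> carrier A" and jc: "j \<in> carrier A"
    using g_carrier J_closed[OF j] by auto
  have "\<exists>x\<in>X. g j \<preceq> x"
  proof (rule ccontr)
    assume n: "\<not> (\<exists>x\<in>X. g j \<preceq> x)"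
    have "x \<preceq> neg A j" if "x \<in> X" for x
      using that n g_le_iff[OF j subsetD[OF X that]] by blast
    then have "g j \<preceq> neg A j"
      unfolding eq by (intro Sup_le[OF X neg_closed[OF jc]])
    then show False using g_le_iff[OF j gc] gc by simp
  qed
  then obtain x where x: "x \<in> X" "g j \<preceq> x" by blast
  moreover have "x \<preceq> g j" using le_Sup[OF X x(1)] eq by simp
  ultimately have "g j = x" using le_antisym' gc X by blast
  then show "\<Squnion>\<^bsub>lat_order A\<^esub>X \<in> X" using eq x by simp
qed

lemma J_le_neg_iff:
  assumes "j \<in> J" "x \<in> carrier A"
  shows "j \<preceq> neg A x \<longleftrightarrow> \<not> g j \<preceq> x"
  using assms g_le_iff le_neg_iff J_closed by blast

text \<open>Two passes through negation cancel, so \<open>g (g j)\<close> and \<open>j\<close> lie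
  below the same elements.\<close>

lemma g_g:
  assumes j: "j \<in> J"
  shows "g (g j) = j"
proof (rule le_antisym')
  have *: "g (g j) \<preceq> x \<longleftrightarrow> j \<preceq> x" if x: "x \<in> carrier A" for x
  proof -
    have "g (g j) \<preceq> x \<longleftrightarrow> \<not> g j \<preceq> neg A x"
      using J_le_neg_iff[OF g_J[OF j] x] by blast
    also have "\<dots> \<longleftrightarrow> neg A x \<preceq> neg A j"
      using g_le_iff[OF j neg_closed[OF x]] by blast
    finally show ?thesis using neg_antitone J_closed[OF j] x by blast
  qed
  show "g (g j) \<preceq> j" "j \<preceq> g (g j)"
    using *[of j] *[of "g (g j)"] J_closed g_J j by auto
qed (use J_closed g_J j in auto)

lemma g_antitone:
  assumes j: "j \<in> J" and k: "k \<in> J" and le: "j \<preceq> k"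
  shows "g k \<preceq> g j"
proof (rule ccontr)
  have c: "j \<in> carrier A" "k \<in> carrier A" "g j \<in> carrier A" "neg A j \<in> carrier A" "neg A k \<in> carrier A"
    using j k J_closed g_carrier neg_closed by auto
  assume "\<not> g k \<preceq> g j"
  then have "g j \<preceq> neg A k" using g_le_iff[OF k c(3)] by blast
  moreover have "neg A k \<preceq> neg A j" using le neg_antitone c by blast
  ultimately have "g j \<preceq> neg A j" using c le_trans' by blast
  then show False using g_le_iff[OF j c(3)] c by simp
qed

text \<open>The Kleene inequality at \<open>j\<close> and \<open>g j\<close>: if these were
  incomparable, each would lie below its own negation, and the inequality would put \<open>j\<close>
  below \<open>neg A (g j)\<close>.\<close>

lemma g_comparable:
  assumes j: "j \<in> J"
  shows "j \<preceq> g j \<or> g j \<preceq> j"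
proof (rule ccontr)
  assume n: "\<not> (j \<preceq> g j \<or> g j \<preceq> j)"
  have c: "j \<in> carrier A" "g j \<in> carrier A" "neg A j \<in> carrier A" "neg A (g j) \<in> carrier A"
    using j J_closed g_carrier neg_closed by auto
  have 1: "j \<preceq> neg A j"
    using n J_le_neg_iff[OF j] c by blast
  have 2: "g j \<preceq> neg A (g j)"
    using n J_le_neg_iff[OF g_J[OF j], of "g j"] c g_g[OF j] by simp
  have "j \<preceq> vee A (g j) (neg A (g j))"
    using kleene[OF c(1,2)] 1 by (simp add: le_lat_order)
  then have "j \<preceq> neg A (g j)"
    using 2 c by (simp add: le_iff_vee)
  then show False
    using J_le_neg_iff[OF j c(2)] c by simp
qed

text \<open>The interpolation property: the law \<open>(a \<and> b) \<rightarrow> c = a \<rightarrow> (b \<rightarrow> c)\<close> for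
  \<open>a = g p\<close>, \<open>b = g q\<close>, \<open>c = 0\<close>.\<close>

lemma interpolation:
  assumes p: "p \<in> J" "p \<preceq> g p" and q: "q \<in> J" "q \<preceq> g q" and pq: "q \<preceq> g p"
  shows "\<exists>k\<in>J. p \<preceq> k \<and> q \<preceq> k \<and> k \<preceq> g p \<and> k \<preceq> g q"
proof (rule ccontr)
  assume none: "\<not> ?thesis"
  have c: "p \<in> carrier A" "q \<in> carrier A" "g p \<in> carrier A" "g q \<in> carrier A" "zero A \<in> carrier A"
    using p q J_closed g_carrier zero_closed by auto
  let ?ab = "wedge A (g p) (g q)"
  have ab: "?ab \<in> carrier A" "neg A ?ab \<in> carrier A" using c wedge_closed neg_closed by auto
  \<comment> \<open>A \<open>j\<close> in \<open>J\<close> violating this would have both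
    \<open>j\<close> and \<open>g j\<close> below \<open>g p\<close> and \<open>g q\<close>;
    antitonicity then makes \<open>j\<close> the missing interpolant.\<close>
  have "wedge A ?ab (g p) \<preceq> vee A (neg A ?ab) (zero A)"
    unfolding vee_zero[OF ab(2)]
  proof (subst le_iff_J; (intro ballI impI)?)
    fix j assume j: "j \<in> J" and "j \<preceq> wedge A ?ab (g p)"
    then have jp: "j \<preceq> g p" "j \<preceq> g q"
      using c ab J_closed by (simp_all add: le_wedge_iff)
    show "j \<preceq> neg A ?ab"
    proof (rule ccontr)
      assume "\<not> j \<preceq> neg A ?ab"
      then have "g j \<preceq> g p" "g j \<preceq> g q"
        using J_le_neg_iff[OF j ab(1)] c J_closed[OF g_J[OF j]] by (simp_all add: le_wedge_iff)
      then have "p \<preceq> j" "q \<preceq> j"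
        using g_antitone[OF g_J[OF j] g_J[OF p(1)]] g_antitone[OF g_J[OF j] g_J[OF q(1)]]
          g_g j p q by simp_all
      then show False using none j jp by blast
    qed
  qed (use c ab wedge_closed in auto)
  then have "g p \<preceq> arrow A (g p) (arrow A (g q) (zero A))"
    using arrow_residual[OF ab(1) c(5,3)] arrow_curry[OF c(3-5)] by simp
  then have "wedge A (g p) (g p) \<preceq> vee A (neg A (g p)) (arrow A (g q) (zero A))"
    using arrow_residual[OF c(3) arrow_closed[OF c(4,5)] c(3)] by simp
  \<comment> \<open>\<open>g p\<close> is join-prime, and the first alternative fails because
    \<open>p\<close> lies below \<open>g p\<close>.\<close>
  then have "g p \<preceq> neg A (g p) \<or> g p \<preceq> arrow A (g q) (zero A)"
    using J_vee_iff[OF g_J[OF p(1)]] neg_closed arrow_closed c wedge_idem by simp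
  moreover have "\<not> g p \<preceq> neg A (g p)"
    using J_le_neg_iff[OF g_J[OF p(1)] c(3)] g_g p by simp
  ultimately have "wedge A (g q) (g p) \<preceq> neg A (g q)"
    using arrow_residual[OF c(4,5,3)] vee_zero neg_closed c by simp
  moreover have "q \<preceq> wedge A (g q) (g p)"
    using c q pq by (simp add: le_wedge_iff)
  ultimately have "q \<preceq> neg A (g q)"
    using c wedge_closed neg_closed le_trans' by meson
  then show False
    using J_le_neg_iff[OF q(1) c(4)] c by simp
qed

end

section \<open>Effective rough sets\<close>

lemma closed_sets_carrier_iff:
  assumes "preorder_on U R"
  shows "Z \<in> carrier (closed_sets U R) \<longleftrightarrow> Z \<subseteq> U \<and> R `` Z \<subseteq> Z"
proof
  assume "Z \<in> carrier (closed_sets U R)"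
  then show "Z \<subseteq> U \<and> R `` Z \<subseteq> Z"
    using assms unfolding closed_sets_def lower_approx_def preorder_on_def
    by (auto dest: transD)
next
  assume "Z \<subseteq> U \<and> R `` Z \<subseteq> Z"
  then have "Z \<subseteq> U" "Z = lower_approx U R Z"
    using assms unfolding lower_approx_def preorder_on_def refl_on_def by auto
  then show "Z \<in> carrier (closed_sets U R)"
    unfolding closed_sets_def by auto
qed

lemma pseudocomplement_closed_sets:
  assumes "preorder_on U R"
  shows "himp (closed_sets U R) Z (zero (closed_sets U R)) = {x \<in> U. R `` {x} \<inter> Z = {}}"
  using assms unfolding closed_sets_def lower_approx_def preorder_on_def by auto

lemma singleton_pointsD: "s \<in> singleton_points U R \<Longrightarrow> (s, y) \<in> R \<Longrightarrow> y = s"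
  by (auto simp: singleton_points_def)

text \<open>Two closed sets have the same pseudocomplement when they are met from the same points.
  If every point reaches \<open>S\<close>, a closed set is met from a point exactly when its part in
  \<open>S\<close> is. If \<open>x\<close> does not reach \<open>S\<close>, then R(x) and the empty
  set agree on \<open>S\<close> but have different pseudocomplements.\<close>

lemma effective_IRS_iff:
  assumes pre: "preorder_on U R"
  shows "effective_IRS U R \<longleftrightarrow> (\<forall>x\<in>U. \<exists>s\<in>singleton_points U R. (x, s) \<in> R)"
proof -
  let ?S = "singleton_points U R"
  let ?H = "closed_sets U R"
  have RU: "R \<subseteq> U \<times> U" and rf: "\<And>x. x \<in> U \<Longrightarrow> (x, x) \<in> R"
    and tr: "\<And>x y z. (x, y) \<in> R \<Longrightarrow> (y, z) \<in> R \<Longrightarrow> (x, z) \<in> R"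
    using pre unfolding preorder_on_def refl_on_def trans_def by blast+
  have S: "s \<in> U" "(s, s) \<in> R" if "s \<in> ?S" for s
    using that rf by (auto simp: singleton_points_def)
  show ?thesis
  proof
    assume eff: "effective_IRS U R"
    show "\<forall>x\<in>U. \<exists>s\<in>?S. (x, s) \<in> R"
    proof (rule ccontr)
      assume "\<not> (\<forall>x\<in>U. \<exists>s\<in>?S. (x, s) \<in> R)"
      then obtain x where x: "x \<in> U" "\<And>s. s \<in> ?S \<Longrightarrow> (x, s) \<notin> R" by blast
      have "R `` {x} \<in> carrier ?H" "{} \<in> carrier ?H"
        using RU tr by (auto simp: closed_sets_carrier_iff[OF pre])
      then have "(R `` {x}, {}) \<in> cong_S U R"
        using x(2) by (auto simp: cong_S_def)
      then have "(R `` {x}, {}) \<in> glivenko_congruence ?H"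
        using eff by (simp add: effective_IRS_def)
      then have "{y \<in> U. R `` {y} \<inter> R `` {x} = {}} = U"
        by (simp add: glivenko_congruence_def pseudocomplement_closed_sets[OF pre])
      then show False using x(1) rf by blast
    qed
  next
    assume reach: "\<forall>x\<in>U. \<exists>s\<in>?S. (x, s) \<in> R"
    have "X \<inter> ?S = Y \<inter> ?S \<longleftrightarrow> {x \<in> U. R `` {x} \<inter> X = {}} = {x \<in> U. R `` {x} \<inter> Y = {}}"
      if X: "X \<in> carrier ?H" and Y: "Y \<in> carrier ?H" for X Y
    proof
      have XY: "X \<subseteq> U" "R `` X \<subseteq> X" "Y \<subseteq> U" "R `` Y \<subseteq> Y"
        using X Y by (simp_all add: closed_sets_carrier_iff[OF pre])
      have mem: "(s \<in> Z) = (R `` {s} \<inter> Z \<noteq> {})" if "s \<in> ?S" for s Z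
        using that by (auto simp: singleton_points_def)
      show "X \<inter> ?S = Y \<inter> ?S" if "{x \<in> U. R `` {x} \<inter> X = {}} = {x \<in> U. R `` {x} \<inter> Y = {}}"
        using that S(1) mem by blast
      \<comment> \<open>From a point of the closed set \<open>Z\<close> one can move on to a point
        of \<open>S\<close>, still inside \<open>Z\<close>.\<close>
      have char: "{x \<in> U. R `` {x} \<inter> Z = {}} = {x \<in> U. R `` {x} \<inter> (Z \<inter> ?S) = {}}"
        if Z: "Z \<subseteq> U" "R `` Z \<subseteq> Z" for Z
      proof -
        have "R `` {x} \<inter> (Z \<inter> ?S) \<noteq> {}" if xy: "(x, y) \<in> R" "y \<in> Z" for x y
        proof -
          obtain s where "s \<in> ?S" "(y, s) \<in> R" using reach Z xy by blast
          then show ?thesis using xy Z tr by blast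
        qed
        then show ?thesis by blast
      qed
      show "{x \<in> U. R `` {x} \<inter> X = {}} = {x \<in> U. R `` {x} \<inter> Y = {}}" if "X \<inter> ?S = Y \<inter> ?S"
        using char[of X] char[of Y] XY that by simp
    qed
    then show "effective_IRS U R"
      unfolding effective_IRS_def cong_S_def glivenko_congruence_def
        pseudocomplement_closed_sets[OF pre]
      by (intro Collect_cong) (simp add: case_prod_unfold cong: conj_cong)
  qed
qed

text \<open>For the nontrivial direction, \<open>(P, Q)\<close> is realised by adding to \<open>P\<close> the points of \<open>Q\<close> that
  do not reach \<open>P\<close>: such a point sees a singleton point, which lies outside \<open>Q\<close>.\<close>

lemma IRS_carrier_iff:
  assumes pre: "preorder_on U R" and eff: "effective_IRS U R"
  shows "(P, Q) \<in> carrier (IRS U R) \<longleftrightarrow>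
    P \<subseteq> Q \<and> Q \<subseteq> U \<and> R `` P \<subseteq> P \<and> R\<inverse> `` Q \<subseteq> Q \<and> singleton_points U R \<inter> Q \<subseteq> P"
    (is "_ \<longleftrightarrow> ?rhs")
proof -
  have RU: "R \<subseteq> U \<times> U" and rf: "\<And>x. x \<in> U \<Longrightarrow> (x, x) \<in> R"
    and tr: "\<And>x y z. (x, y) \<in> R \<Longrightarrow> (y, z) \<in> R \<Longrightarrow> (x, z) \<in> R"
    using pre unfolding preorder_on_def refl_on_def trans_def by blast+
  show ?thesis
  proof
    assume "(P, Q) \<in> carrier (IRS U R)"
    then obtain X where X: "X \<subseteq> U" "P = lower_approx U R X" "Q = upper_approx U R X"
      by (auto simp: IRS_def)
    show ?rhs
    proof (intro conjI)
      show "P \<subseteq> Q"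
        unfolding X(2,3) lower_approx_def upper_approx_def using rf by blast
      show "Q \<subseteq> U"
        unfolding X(3) upper_approx_def by blast
      show "R `` P \<subseteq> P"
        unfolding X(2) lower_approx_def using RU tr by blast
      show "R\<inverse> `` Q \<subseteq> Q"
      proof
        fix x assume "x \<in> R\<inverse> `` Q"
        then obtain y z where "(x, y) \<in> R" "(y, z) \<in> R" "z \<in> X"
          unfolding X(3) upper_approx_def by blast
        then show "x \<in> Q"
          using tr RU unfolding X(3) upper_approx_def by blast
      qed
      show "singleton_points U R \<inter> Q \<subseteq> P"
      proof
        fix s assume "s \<in> singleton_points U R \<inter> Q"
        then have s: "s \<in> U" "R `` {s} = {s}" "R `` {s} \<inter> X \<noteq> {}"
          unfolding X(3) upper_approx_def singleton_points_def by blast+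
        from s(3) have "s \<in> X" unfolding s(2) by blast
        with s(1,2) show "s \<in> P" by (simp add: X(2) lower_approx_def)
      qed
    qed
  next
    assume r: ?rhs
    define X where "X = P \<union> {x \<in> Q. R `` {x} \<inter> P = {}}"
    have "lower_approx U R X = P"
    proof
      show "P \<subseteq> lower_approx U R X"
        unfolding lower_approx_def X_def using r by blast
      show "lower_approx U R X \<subseteq> P"
      proof
        fix x assume "x \<in> lower_approx U R X"
        then have x: "x \<in> U" "R `` {x} \<subseteq> X" by (auto simp: lower_approx_def)
        then obtain s where s: "s \<in> singleton_points U R" "(x, s) \<in> R"
          using eff effective_IRS_iff[OF pre] by blast
        then have "s \<in> Q" using x r by (auto simp: X_def)
        then have "s \<in> P" using s r by blast
        then show "x \<in> P" using x rf s by (auto simp: X_def)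
      qed
    qed
    moreover have "upper_approx U R X = Q"
    proof
      show "upper_approx U R X \<subseteq> Q"
      proof
        fix x assume "x \<in> upper_approx U R X"
        then obtain y where "(x, y) \<in> R" "y \<in> X" by (auto simp: upper_approx_def)
        moreover have "X \<subseteq> Q" using r by (auto simp: X_def)
        ultimately show "x \<in> Q" using r by blast
      qed
      show "Q \<subseteq> upper_approx U R X"
      proof
        fix x assume x: "x \<in> Q"
        then have "x \<in> U" "(x, x) \<in> R" using r rf by blast+
        then show "x \<in> upper_approx U R X"
          using x by (cases "R `` {x} \<inter> P = {}") (auto simp: upper_approx_def X_def)
      qed
    qed
    moreover have "X \<subseteq> U" using r by (auto simp: X_def)
    ultimately show "(P, Q) \<in> carrier (IRS U R)"
      by (auto simp: IRS_def)
  qed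
qed


section \<open>From rough sets to algebraic lattices\<close>

text \<open>The isomorphism is a parameter, so completeness, compactness and \<open>g_map\<close>
  are handled in \<open>A\<close> itself by computing with the two coordinates of
  \<open>f a\<close>.\<close>

locale effective_representation = nelson_algebra A for A :: "('a, 'm) nelson_scheme" +
  fixes U :: "'u set" and R :: "'u rel" and f :: "'a \<Rightarrow> 'u set \<times> 'u set"
  assumes preorder: "preorder_on U R" and effective: "effective_IRS U R"
    and iso: "nelson_iso A (IRS U R) f"
begin

definition lo where "lo a = fst (f a)"
definition up where "up a = snd (f a)"

abbreviation S where "S \<equiv> singleton_points U R"

lemma R_refl: "x \<in> U \<Longrightarrow> (x, x) \<in> R"
  and R_trans: "(x, y) \<in> R \<Longrightarrow> (y, z) \<in> R \<Longrightarrow> (x, z) \<in> R"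
  and R_sub: "(x, y) \<in> R \<Longrightarrow> x \<in> U \<and> y \<in> U"
  using preorder unfolding preorder_on_def refl_on_def trans_def by blast+

lemma f_carrier: "a \<in> carrier A \<Longrightarrow> (lo a, up a) \<in> carrier (IRS U R)"
  using iso by (auto simp: nelson_iso_def lo_def up_def bij_betw_def)

lemma lo_up:
  assumes "a \<in> carrier A"
  shows "lo a \<subseteq> up a" "up a \<subseteq> U" "S \<inter> up a \<subseteq> lo a"
    and "\<And>x y. x \<in> lo a \<Longrightarrow> (x, y) \<in> R \<Longrightarrow> y \<in> lo a"
    and "\<And>x y. y \<in> up a \<Longrightarrow> (x, y) \<in> R \<Longrightarrow> x \<in> up a"
  using f_carrier[OF assms] unfolding IRS_carrier_iff[OF preorder effective] by blast+

text \<open>Joins, meets and generators are all constructed through this lemma: surjectivity of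
  \<open>f\<close> combined with the description of rough sets.\<close>

lemma realise:
  assumes "P \<subseteq> Q" "Q \<subseteq> U" "S \<inter> Q \<subseteq> P"
    and "\<And>x y. x \<in> P \<Longrightarrow> (x, y) \<in> R \<Longrightarrow> y \<in> P"
    and "\<And>x y. y \<in> Q \<Longrightarrow> (x, y) \<in> R \<Longrightarrow> x \<in> Q"
  shows "\<exists>a. a \<in> carrier A \<and> lo a = P \<and> up a = Q"
proof -
  have "(P, Q) \<in> carrier (IRS U R)"
    unfolding IRS_carrier_iff[OF preorder effective] using assms by blast
  then have "(P, Q) \<in> f ` carrier A"
    using iso by (simp add: nelson_iso_def bij_betw_def)
  then obtain a where "a \<in> carrier A" "f a = (P, Q)"
    by (metis imageE)
  then show ?thesis by (auto simp: lo_def up_def)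
qed

lemma eqI: "a \<in> carrier A \<Longrightarrow> b \<in> carrier A \<Longrightarrow> lo a = lo b \<Longrightarrow> up a = up b \<Longrightarrow> a = b"
  using iso by (auto simp: nelson_iso_def lo_def up_def bij_betw_def inj_on_def prod_eq_iff)

lemma lo_wedge: "a \<in> carrier A \<Longrightarrow> b \<in> carrier A \<Longrightarrow> lo (wedge A a b) = lo a \<inter> lo b"
  and up_wedge: "a \<in> carrier A \<Longrightarrow> b \<in> carrier A \<Longrightarrow> up (wedge A a b) = up a \<inter> up b"
  using iso by (auto simp: nelson_iso_def lo_def up_def IRS_def split_beta)

lemma lo_neg: "a \<in> carrier A \<Longrightarrow> lo (neg A a) = U - up a"
  and up_neg: "a \<in> carrier A \<Longrightarrow> up (neg A a) = U - lo a"
  using iso by (auto simp: nelson_iso_def lo_def up_def IRS_def split_beta)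

lemma le_iff: "a \<in> carrier A \<Longrightarrow> b \<in> carrier A \<Longrightarrow> a \<preceq> b \<longleftrightarrow> lo a \<subseteq> lo b \<and> up a \<subseteq> up b"
  unfolding le_lat_order using eqI lo_wedge up_wedge wedge_closed by (metis inf.orderE inf_le2)

text \<open>The conditions of \<open>realise\<close> survive arbitrary unions, so joins are
  coordinatewise; the coordinates are exported for \<open>Sup_eq\<close>.\<close>

lemma least_upper:
  assumes X: "X \<subseteq> carrier A"
  obtains s where "s \<in> carrier A" "lo s = (\<Union>a\<in>X. lo a)" "up s = (\<Union>a\<in>X. up a)"
    "least (lat_order A) s (Upper (lat_order A) X)"
proof -
  have "\<exists>s. s \<in> carrier A \<and> lo s = (\<Union>a\<in>X. lo a) \<and> up s = (\<Union>a\<in>X. up a)"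
  proof (rule realise)
    show "(\<Union>a\<in>X. lo a) \<subseteq> (\<Union>a\<in>X. up a)" "(\<Union>a\<in>X. up a) \<subseteq> U"
      "S \<inter> (\<Union>a\<in>X. up a) \<subseteq> (\<Union>a\<in>X. lo a)"
      using lo_up(1-3)[OF subsetD[OF X]] by fast+
    show "y \<in> (\<Union>a\<in>X. lo a)" if "x \<in> (\<Union>a\<in>X. lo a)" "(x, y) \<in> R" for x y
      using that lo_up(4)[OF subsetD[OF X] _ that(2)] by auto
    show "x \<in> (\<Union>a\<in>X. up a)" if "y \<in> (\<Union>a\<in>X. up a)" "(x, y) \<in> R" for x y
      using that lo_up(5)[OF subsetD[OF X] _ that(2)] by auto
  qed
  then obtain s where s: "s \<in> carrier A" "lo s = (\<Union>a\<in>X. lo a)" "up s = (\<Union>a\<in>X. up a)"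
    by blast
  have "least (lat_order A) s (Upper (lat_order A) X)"
  proof (rule least_UpperI)
    fix y assume "y \<in> Upper (lat_order A) X"
    then have y: "y \<in> carrier A" "\<And>x. x \<in> X \<Longrightarrow> x \<preceq> y"
      using X by (auto simp: Upper_def)
    have "lo x \<subseteq> lo y \<and> up x \<subseteq> up y" if "x \<in> X" for x
      using y(2)[OF that] le_iff[OF subsetD[OF X that] y(1)] by simp
    then show "s \<preceq> y"
      unfolding le_iff[OF s(1) y(1)] s(2,3) by blast
  next
    show "x \<preceq> s" if "x \<in> X" for x
      unfolding le_iff[OF subsetD[OF X that] s(1)] s(2,3) using that by blast
  qed (use X s in auto)
  then show ?thesis using that s by blast
qed

lemma greatest_lower:
  assumes X: "X \<subseteq> carrier A"
  shows "\<exists>i. greatest (lat_order A) i (Lower (lat_order A) X)"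
proof -
  \<comment> \<open>Intersecting with \<open>U\<close> settles the empty family, whose meet is the
    top pair \<open>(U, U)\<close>.\<close>
  let ?P = "U \<inter> (\<Inter>a\<in>X. lo a)" and ?Q = "U \<inter> (\<Inter>a\<in>X. up a)"
  have "\<exists>i. i \<in> carrier A \<and> lo i = ?P \<and> up i = ?Q"
  proof (rule realise[of ?P ?Q])
    show "?P \<subseteq> ?Q"
      using lo_up(1)[OF subsetD[OF X]] by fast
    show "S \<inter> ?Q \<subseteq> ?P"
    proof
      fix s assume s: "s \<in> S \<inter> ?Q"
      then have "s \<in> lo a" if "a \<in> X" for a
        using that lo_up(3)[OF subsetD[OF X that]] by blast
      then show "s \<in> ?P" using s by blast
    qed
    show "y \<in> ?P" if "x \<in> ?P" "(x, y) \<in> R" for x y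
      using that lo_up(4)[OF subsetD[OF X] _ that(2)] R_sub[OF that(2)] by simp
    show "x \<in> ?Q" if "y \<in> ?Q" "(x, y) \<in> R" for x y
      using that lo_up(5)[OF subsetD[OF X] _ that(2)] R_sub[OF that(2)] by simp
  qed auto
  then obtain i where i: "i \<in> carrier A" "lo i = ?P" "up i = ?Q" by blast
  have "greatest (lat_order A) i (Lower (lat_order A) X)"
  proof (rule greatest_LowerI)
    show "i \<preceq> x" if "x \<in> X" for x
      using that i le_iff[OF i(1) subsetD[OF X that]] by auto
    fix y assume "y \<in> Lower (lat_order A) X"
    then have y: "y \<in> carrier A" "\<And>x. x \<in> X \<Longrightarrow> y \<preceq> x"
      using X by (auto simp: Lower_def)
    have "lo y \<subseteq> lo x \<and> up y \<subseteq> up x" if "x \<in> X" for x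
      using y(2)[OF that] le_iff[OF y(1) subsetD[OF X that]] by simp
    then show "y \<preceq> i"
      using i lo_up(1,2)[OF y(1)] by (simp add: le_iff[OF y(1) i(1)]) blast
  qed (use X i in auto)
  then show ?thesis by blast
qed

lemma complete_lattice: "complete_lattice (lat_order A)"
proof unfold_locales
  fix X assume "X \<subseteq> carrier (lat_order A)"
  then have X: "X \<subseteq> carrier A" by simp
  show "\<exists>s. least (lat_order A) s (Upper (lat_order A) X)"
    using least_upper[OF X] by metis
  show "\<exists>i. greatest (lat_order A) i (Lower (lat_order A) X)"
    using greatest_lower[OF X] .
qed

lemma Sup_eq:
  assumes "X \<subseteq> carrier A"
  shows "\<Squnion>\<^bsub>lat_order A\<^esub>X \<in> carrier A" "lo (\<Squnion>\<^bsub>lat_order A\<^esub>X) = (\<Union>a\<in>X. lo a)"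
    "up (\<Squnion>\<^bsub>lat_order A\<^esub>X) = (\<Union>a\<in>X. up a)"
proof -
  obtain s where s: "s \<in> carrier A" "lo s = (\<Union>a\<in>X. lo a)" "up s = (\<Union>a\<in>X. up a)"
    "least (lat_order A) s (Upper (lat_order A) X)"
    using least_upper[OF assms] by metis
  \<comment> \<open>The supremum is defined by choice; uniqueness of least upper bounds identifies
    it with \<open>s\<close>.\<close>
  have "\<Squnion>\<^bsub>lat_order A\<^esub>X = s"
    unfolding sup_def using s(4) least_unique by (metis someI)
  then show "\<Squnion>\<^bsub>lat_order A\<^esub>X \<in> carrier A" "lo (\<Squnion>\<^bsub>lat_order A\<^esub>X) = (\<Union>a\<in>X. lo a)"
    "up (\<Squnion>\<^bsub>lat_order A\<^esub>X) = (\<Union>a\<in>X. up a)"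
    using s by auto
qed

text \<open>In the notation of the paper, the two kinds of completely join-irreducibles are
  \<open>({}, {x}\<^sup>R)\<close> with \<open>x \<notin> S\<close> and \<open>(R(x), R(x)\<^sup>R)\<close>.\<close>

definition up_generator where "up_generator x a \<longleftrightarrow> a \<in> carrier A \<and> x \<in> U - S \<and> lo a = {} \<and> up a = R\<inverse> `` {x}"
definition lo_generator where "lo_generator x a \<longleftrightarrow> a \<in> carrier A \<and> x \<in> U \<and> lo a = R `` {x} \<and> up a = R\<inverse> `` (R `` {x})"

text \<open>Closure of the coordinates reduces comparison with a generator to membership of one
  point in one coordinate. Since joins are unions there, complete primeness follows in
  \<open>generator_prime\<close>.\<close>

lemma up_generator_le_iff: "up_generator x c \<Longrightarrow> a \<in> carrier A \<Longrightarrow> c \<preceq> a \<longleftrightarrow> x \<in> up a"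
  unfolding up_generator_def using lo_up(5) R_refl by (auto simp: le_iff)

lemma lo_generator_le_iff: "lo_generator x d \<Longrightarrow> a \<in> carrier A \<Longrightarrow> d \<preceq> a \<longleftrightarrow> x \<in> lo a"
  unfolding lo_generator_def using lo_up(1,4,5) R_refl by (auto simp: le_iff) blast+

lemma ex_up_generator: "x \<in> U - S \<Longrightarrow> \<exists>c. up_generator x c"
proof -
  assume x: "x \<in> U - S"
  \<comment> \<open>A point of \<open>S\<close> that sees \<open>x\<close> is \<open>x\<close>
    itself, so for \<open>x\<close> outside \<open>S\<close> an empty lower coordinate is
    admissible.\<close>
  then have "S \<inter> R\<inverse> `` {x} \<subseteq> {}" by (auto dest: singleton_pointsD)
  then have "\<exists>c. c \<in> carrier A \<and> lo c = {} \<and> up c = R\<inverse> `` {x}"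
    by (intro realise) (use R_sub R_trans in blast)+
  then show ?thesis using x by (simp add: up_generator_def)
qed

lemma ex_lo_generator: "x \<in> U \<Longrightarrow> \<exists>d. lo_generator x d"
proof -
  assume x: "x \<in> U"
  have "R `` {x} \<subseteq> R\<inverse> `` (R `` {x})" "R\<inverse> `` (R `` {x}) \<subseteq> U"
    using R_sub R_refl by blast+
  moreover have "S \<inter> R\<inverse> `` (R `` {x}) \<subseteq> R `` {x}"
    by (auto dest: singleton_pointsD)
  ultimately have "\<exists>d. d \<in> carrier A \<and> lo d = R `` {x} \<and> up d = R\<inverse> `` (R `` {x})"
    by (rule realise) (use R_trans in blast)+
  then show ?thesis using x by (simp add: lo_generator_def)
qed

section \<open>Generators: compactness, join-density, complete join-irreducibility\<close>

definition generators where "generators = {a. \<exists>x. up_generator x a \<or> lo_generator x a}"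

lemma generators_closed: "generators \<subseteq> carrier A"
  by (auto simp: generators_def up_generator_def lo_generator_def)

lemma generator_prime:
  assumes a: "a \<in> generators" and X: "X \<subseteq> carrier A" and le: "a \<preceq> \<Squnion>\<^bsub>lat_order A\<^esub>X"
  shows "\<exists>b\<in>X. a \<preceq> b"
proof -
  obtain x where "up_generator x a \<or> lo_generator x a"
    using a by (auto simp: generators_def)
  then show ?thesis
  proof
    assume c: "up_generator x a"
    then obtain b where "b \<in> X" "x \<in> up b"
      using up_generator_le_iff[OF c] le Sup_eq[OF X] by auto
    then show ?thesis using up_generator_le_iff[OF c subsetD[OF X]] by blast
  next
    assume d: "lo_generator x a"
    then obtain b where "b \<in> X" "x \<in> lo b"
      using lo_generator_le_iff[OF d] le Sup_eq[OF X] by auto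
    then show ?thesis using lo_generator_le_iff[OF d subsetD[OF X]] by blast
  qed
qed

lemma generators_compact: "generators \<subseteq> compact_elements (lat_order A)"
proof
  fix a assume a: "a \<in> generators"
  have "\<exists>F. finite F \<and> F \<subseteq> X \<and> a \<preceq> \<Squnion>\<^bsub>lat_order A\<^esub>F"
    if X: "X \<subseteq> carrier A" and le: "a \<preceq> \<Squnion>\<^bsub>lat_order A\<^esub>X" for X
  proof -
    obtain b where b: "b \<in> X" "a \<preceq> b" using generator_prime[OF a X le] by blast
    then have "\<Squnion>\<^bsub>lat_order A\<^esub>{b} = b" using X sup_of_singleton[of b] by auto
    then show ?thesis using b by (intro exI[of _ "{b}"]) auto
  qed
  then show "a \<in> compact_elements (lat_order A)"
    using a generators_closed by (auto simp: compact_elements_def)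
qed

lemma Sup_generators:
  assumes a: "a \<in> carrier A"
  shows "a = \<Squnion>\<^bsub>lat_order A\<^esub>{b \<in> generators. b \<preceq> a}"
proof -
  let ?X = "{b \<in> generators. b \<preceq> a}"
  have X: "?X \<subseteq> carrier A" using generators_closed by auto
  note sup = Sup_eq[OF X]
  have "\<Squnion>\<^bsub>lat_order A\<^esub>?X \<preceq> a"
    unfolding le_iff[OF sup(1) a] sup(2,3) using le_iff[OF subsetD[OF X] a] by blast
  moreover have "lo a \<subseteq> (\<Union>b\<in>?X. lo b)"
  proof
    fix x assume x: "x \<in> lo a"
    then obtain d where d: "lo_generator x d" using ex_lo_generator lo_up(1,2)[OF a] by blast
    then have "d \<in> ?X" using lo_generator_le_iff[OF d a] x by (auto simp: generators_def)
    moreover have "x \<in> lo d" using d R_refl by (auto simp: lo_generator_def)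
    ultimately show "x \<in> (\<Union>b\<in>?X. lo b)" by blast
  qed
  moreover have "up a \<subseteq> (\<Union>b\<in>?X. up b)"
  proof
    fix x assume x: "x \<in> up a"
    then have xU: "x \<in> U" using lo_up(2)[OF a] by blast
    \<comment> \<open>A point of \<open>S\<close> has no \<open>up_generator\<close>, but it already
      lies in \<open>lo a\<close>, so the inclusion of lower coordinates covers it.\<close>
    show "x \<in> (\<Union>b\<in>?X. up b)"
    proof (cases "x \<in> S")
      case True
      then have "x \<in> lo a" using x lo_up(3)[OF a] by blast
      then obtain b where "b \<in> ?X" "x \<in> lo b"
        using \<open>lo a \<subseteq> (\<Union>b\<in>?X. lo b)\<close> by blast
      then show ?thesis using lo_up(1)[OF subsetD[OF X]] by blast
    next
      case False
      then obtain c where c: "up_generator x c" using ex_up_generator xU by blast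
      then have "c \<in> ?X" using up_generator_le_iff[OF c a] x by (auto simp: generators_def)
      moreover have "x \<in> up c" using c R_refl xU by (auto simp: up_generator_def)
      ultimately show ?thesis by blast
    qed
  qed
  ultimately show ?thesis
    using sup a by (intro le_antisym') (auto simp: le_iff)
qed

lemma algebraic_lattice: "algebraic_lattice (lat_order A)"
  unfolding algebraic_lattice_def
proof (intro conjI ballI complete_lattice)
  fix x assume "x \<in> carrier (lat_order A)"
  then have x: "x \<in> carrier A" by simp
  show "\<exists>C\<subseteq>compact_elements (lat_order A). x = \<Squnion>\<^bsub>lat_order A\<^esub>C"
    by (rule exI[of _ "{b \<in> generators. b \<preceq> x}"]) (use generators_compact Sup_generators[OF x] in auto)
qed

lemma comp_join_irr_generator:
  assumes "j \<in> comp_join_irr (lat_order A)"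
  shows "j \<in> generators"
proof -
  have j: "j \<in> carrier A" using assms by (simp add: comp_join_irr_def)
  have "{b \<in> generators. b \<preceq> j} \<subseteq> carrier (lat_order A)" using generators_closed by auto
  then have "j \<in> {b \<in> generators. b \<preceq> j}"
    using assms Sup_generators[OF j] unfolding comp_join_irr_def by blast
  then show ?thesis by blast
qed

lemma generator_comp_join_irr:
  assumes a: "a \<in> generators"
  shows "a \<in> comp_join_irr (lat_order A)"
proof -
  have "a \<in> X" if X: "X \<subseteq> carrier A" and eq: "a = \<Squnion>\<^bsub>lat_order A\<^esub>X" for X
  proof -
    have ac: "a \<in> carrier A" using a generators_closed by blast
    then obtain b where b: "b \<in> X" "a \<preceq> b"
      using generator_prime[OF a X] eq[symmetric] by auto
    have "b \<preceq> a"
      using b(1) X Sup_eq[OF X, folded eq] ac by (subst le_iff) auto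
    then show ?thesis using b X ac le_antisym' by blast
  qed
  then show ?thesis
    using a generators_closed by (auto simp: comp_join_irr_def)
qed

text \<open>For \<open>s\<close> in \<open>S\<close>, lying in the lower and lying in the upper
  coordinate of an element coincide. Hence not being below \<open>neg A d\<close> is the same as
  being above \<open>d\<close>, and the meet defining \<open>g_map A d\<close> is taken over the
  principal filter of \<open>d\<close>.\<close>

lemma g_singleton_point:
  assumes s: "s \<in> S" and d: "lo_generator s d"
  shows "g_map A d = d"
proof -
  have dc: "d \<in> carrier A" using d by (simp add: lo_generator_def)
  have Rs: "R `` {s} = {s}" and sU: "s \<in> U" using s by (auto simp: singleton_points_def)
  let ?X = "{x \<in> carrier A. \<not> x \<preceq> neg A d}"
  have up_iff: "x \<in> ?X \<longleftrightarrow> x \<in> carrier A \<and> d \<preceq> x" for x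
  proof (cases "x \<in> carrier A")
    case x: True
    have "x \<preceq> neg A d \<longleftrightarrow> s \<notin> up x"
    proof
      assume "x \<preceq> neg A d"
      then have "up x \<subseteq> U - lo d"
        using x dc neg_closed by (simp add: le_iff up_neg)
      then show "s \<notin> up x" using d Rs by (auto simp: lo_generator_def)
    next
      assume n: "s \<notin> up x"
      then have "up x \<subseteq> U - {s}" "lo x \<subseteq> U - R\<inverse> `` {s}"
        using lo_up[OF x] Rs by blast+
      then show "x \<preceq> neg A d"
        using x dc d Rs neg_closed by (simp add: le_iff up_neg lo_neg lo_generator_def)
    qed
    then show ?thesis
      using x lo_generator_le_iff[OF d x] lo_up(1,3)[OF x] s by blast
  qed auto
  have "greatest (lat_order A) d (Lower (lat_order A) ?X)"
  proof (rule greatest_LowerI)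
    have "d \<in> ?X" using up_iff dc by simp
    then show "y \<preceq> d" if "y \<in> Lower (lat_order A) ?X" for y
      using that by (auto simp: Lower_def)
  qed (use dc up_iff in auto)
  then show ?thesis
    unfolding g_map_def inf_def using greatest_unique by (metis (no_types, lifting) someI)
qed

text \<open>A generator at \<open>x\<close> is compared with the fixed point at some
  \<open>s\<close> in \<open>S\<close> seen by \<open>x\<close>: an \<open>up_generator\<close> lies
  below it, a \<open>lo_generator\<close> above it.\<close>

lemma comparable_fixed_point:
  assumes "j \<in> comp_join_irr (lat_order A)"
  shows "\<exists>k\<in>comp_join_irr (lat_order A). g_map A k = k \<and> (j \<preceq> k \<or> k \<preceq> j)"
proof -
  obtain x where x: "up_generator x j \<or> lo_generator x j"
    using comp_join_irr_generator[OF assms] by (auto simp: generators_def)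
  then have "x \<in> U" and jc: "j \<in> carrier A" by (auto simp: up_generator_def lo_generator_def)
  then obtain s where s: "s \<in> S" "(x, s) \<in> R"
    using effective effective_IRS_iff[OF preorder] by blast
  then obtain k where k: "lo_generator s k"
    using ex_lo_generator R_sub by blast
  then have kc: "k \<in> carrier A" and kJ: "k \<in> comp_join_irr (lat_order A)"
    using generator_comp_join_irr by (auto simp: generators_def lo_generator_def)
  have "j \<preceq> k \<or> k \<preceq> j"
    using x
  proof
    assume "up_generator x j"
    then show ?thesis
      using up_generator_le_iff[OF _ kc] k s R_sub R_refl by (auto simp: lo_generator_def)
  next
    assume "lo_generator x j"
    then show ?thesis
      using lo_generator_le_iff[OF k jc] s by (auto simp: lo_generator_def)
  qed
  then show ?thesis using kJ g_singleton_point[OF s(1) k] by blast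
qed

end


section \<open>The rough set representation\<close>

context algebraic_nelson_algebra
begin

section \<open>The smaller and the larger member of each pair \<open>x\<close>,
  \<open>g x\<close>\<close>

definition low where "low x = (if x \<preceq> g x then x else g x)"
definition high where "high x = g (low x)"

lemma low_J: "x \<in> J \<Longrightarrow> low x \<in> J"
  and high_J: "x \<in> J \<Longrightarrow> high x \<in> J"
  by (simp_all add: low_def high_def g_J)

lemma low_le_high: "x \<in> J \<Longrightarrow> low x \<preceq> high x"
  using g_comparable g_g by (auto simp: low_def high_def)

lemma low_low: "x \<in> J \<Longrightarrow> low (low x) = low x"
  using low_le_high by (simp add: low_def high_def)

lemma g_high: "x \<in> J \<Longrightarrow> g (high x) = low x"
  by (simp add: high_def g_g low_J)

lemma low_g: "x \<in> J \<Longrightarrow> low (g x) = low x"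
  using g_comparable g_g le_antisym' J_closed g_J by (auto simp: low_def)

lemma low_high: "x \<in> J \<Longrightarrow> low (high x) = low x"
  by (simp add: high_def low_g low_J low_low)

lemma low_or_high: "x \<in> J \<Longrightarrow> x = low x \<or> x = high x"
  using g_g by (auto simp: low_def high_def)

lemma low_le: "x \<in> J \<Longrightarrow> low x \<preceq> x"
  and le_high: "x \<in> J \<Longrightarrow> x \<preceq> high x"
  using low_or_high low_le_high low_J high_J J_closed le_refl by (metis carrier_lat_order)+

lemma high_antitone: "x \<in> J \<Longrightarrow> y \<in> J \<Longrightarrow> low x \<preceq> low y \<Longrightarrow> high y \<preceq> high x"
  by (simp add: high_def g_antitone low_J)

lemma J_trans: "x \<preceq> y \<Longrightarrow> y \<preceq> z \<Longrightarrow> x \<in> J \<Longrightarrow> y \<in> J \<Longrightarrow> z \<in> carrier A \<Longrightarrow> x \<preceq> z"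
  using le_trans' J_closed by blast

text \<open>The interpolant \<open>k\<close> may be either member of its pair, but antitonicity puts
  \<open>g k\<close> above \<open>low x\<close> and \<open>low y\<close> as well, so
  \<open>low k\<close> is above both.\<close>

lemma low_interpolation:
  assumes x: "x \<in> J" and y: "y \<in> J" and le: "low x \<preceq> high y"
  shows "\<exists>k\<in>J. low x \<preceq> low k \<and> low y \<preceq> low k"
proof -
  obtain k where k: "k \<in> J" "low y \<preceq> k" "low x \<preceq> k" "k \<preceq> high y" "k \<preceq> high x"
    using interpolation[of "low y" "low x"] low_J low_le_high x y le unfolding high_def by blast
  have "low y \<preceq> g k" "low x \<preceq> g k"
    using g_antitone[OF k(1) high_J[OF y] k(4)] g_antitone[OF k(1) high_J[OF x] k(5)] g_high x y
    by simp_all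
  then show ?thesis using k by (auto simp: low_def)
qed

definition rel where "rel = {(x, y). x \<in> J \<and> y \<in> J \<and> low x \<preceq> low y}"

definition rough where "rough a = ({x \<in> J. high x \<preceq> a}, {x \<in> J. low x \<preceq> a})"

lemma preorder_rel: "preorder_on J rel"
  unfolding preorder_on_def refl_on_def trans_def rel_def
  using low_J J_closed J_trans by auto

text \<open>Among the points seen by \<open>x\<close>, \<open>low x\<close> is the least and
  \<open>high x\<close> the greatest. Hence all of them lie below \<open>a\<close> iff
  \<open>high x\<close> does, and some of them iff \<open>low x\<close> does.\<close>

lemma rough_eq:
  assumes a: "a \<in> carrier A"
  shows "rough a = (lower_approx J rel {j \<in> J. j \<preceq> a}, upper_approx J rel {j \<in> J. j \<preceq> a})"
proof -
  have "high x \<preceq> a \<longleftrightarrow> (\<forall>y\<in>J. low x \<preceq> low y \<longrightarrow> y \<preceq> a)" if x: "x \<in> J" for x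
  proof
    assume h: "high x \<preceq> a"
    show "\<forall>y\<in>J. low x \<preceq> low y \<longrightarrow> y \<preceq> a"
      using J_trans[OF le_high J_trans[OF high_antitone[OF x] h]] high_J x a by blast
  next
    assume "\<forall>y\<in>J. low x \<preceq> low y \<longrightarrow> y \<preceq> a"
    then show "high x \<preceq> a" using high_J x low_high low_J J_closed by auto
  qed
  moreover have "low x \<preceq> a \<longleftrightarrow> (\<exists>y\<in>J. low x \<preceq> low y \<and> y \<preceq> a)" if x: "x \<in> J" for x
  proof
    assume "low x \<preceq> a"
    then show "\<exists>y\<in>J. low x \<preceq> low y \<and> y \<preceq> a"
      using low_J[OF x] low_low[OF x] J_closed by (intro bexI[of _ "low x"]) auto
  next
    assume "\<exists>y\<in>J. low x \<preceq> low y \<and> y \<preceq> a"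
    then show "low x \<preceq> a"
      using J_trans[OF _ J_trans[OF low_le]] low_J x a by blast
  qed
  ultimately show ?thesis
    by (auto simp: rough_def lower_approx_def upper_approx_def rel_def)
qed

lemma rough_inj: "inj_on rough (carrier A)"
proof -
  have "a \<preceq> b" if "a \<in> carrier A" "b \<in> carrier A" "rough a = rough b" for a b
  proof -
    have "high j \<preceq> a \<longleftrightarrow> high j \<preceq> b" "low j \<preceq> a \<longleftrightarrow> low j \<preceq> b" if "j \<in> J" for j
      using \<open>rough a = rough b\<close> that unfolding rough_def by blast+
    then show ?thesis
      using that low_or_high by (subst le_iff_J) (auto, metis)
  qed
  then show ?thesis using le_antisym' by (auto intro: inj_onI)
qed

text \<open>The candidate is the join of \<open>high\<close> over the lower and \<open>low\<close>
  over the upper approximation. Primeness reduces each membership to a comparison with one of these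
  elements; the mixed comparisons are settled by interpolation or by a collapse to a fixed point of
  \<open>g\<close>.\<close>

lemma rough_surj:
  assumes X: "X \<subseteq> J"
  shows "\<exists>a\<in>carrier A. rough a = (lower_approx J rel X, upper_approx J rel X)"
proof -
  let ?P = "lower_approx J rel X" and ?Q = "upper_approx J rel X"
  let ?G = "high ` ?P \<union> low ` ?Q"
  have PJ: "?P \<subseteq> J" and QJ: "?Q \<subseteq> J" by (auto simp: lower_approx_def upper_approx_def)
  have G: "?G \<subseteq> carrier A" using PJ QJ low_J high_J J_closed by blast
  have P_up: "y \<in> ?P" if "x \<in> ?P" "y \<in> J" "low x \<preceq> low y" for x y
  proof -
    have "low x \<preceq> low z" if "z \<in> J" "low y \<preceq> low z" for z
      using J_trans[OF \<open>low x \<preceq> low y\<close> that(2)] low_J PJ \<open>x \<in> ?P\<close> \<open>y \<in> J\<close> that J_closed by blast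
    then show ?thesis using that unfolding lower_approx_def rel_def by blast
  qed
  have Q_down: "x \<in> ?Q" if "y \<in> ?Q" "x \<in> J" "low x \<preceq> low y" for x y
  proof -
    obtain z where z: "z \<in> X" "z \<in> J" "low y \<preceq> low z"
      using \<open>y \<in> ?Q\<close> unfolding upper_approx_def rel_def by blast
    then have "low x \<preceq> low z"
      using J_trans[OF \<open>low x \<preceq> low y\<close>] low_J QJ that J_closed by blast
    then show ?thesis using that z unfolding upper_approx_def rel_def by blast
  qed
  have P_X: "x \<in> X" if "x \<in> ?P" for x
    using that low_J J_closed unfolding lower_approx_def rel_def by auto
  have X_Q: "x \<in> ?Q" if "x \<in> X" for x
  proof -
    have "x \<in> J" "low x \<in> carrier A" using that X low_J J_closed by auto
    then have "(x, x) \<in> rel" by (simp add: rel_def)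
    then show ?thesis using that \<open>x \<in> J\<close> unfolding upper_approx_def by blast
  qed
  have le_G: "j \<preceq> \<Squnion>\<^bsub>lat_order A\<^esub>?G \<longleftrightarrow> (\<exists>y\<in>?P. j \<preceq> high y) \<or> (\<exists>y\<in>?Q. j \<preceq> low y)"
    if j: "j \<in> J" for j
  proof
    show "(\<exists>y\<in>?P. j \<preceq> high y) \<or> (\<exists>y\<in>?Q. j \<preceq> low y)" if "j \<preceq> \<Squnion>\<^bsub>lat_order A\<^esub>?G"
      using J_prime[OF j G that] by blast
    show "j \<preceq> \<Squnion>\<^bsub>lat_order A\<^esub>?G" if "(\<exists>y\<in>?P. j \<preceq> high y) \<or> (\<exists>y\<in>?Q. j \<preceq> low y)"
      using that le_trans'[OF _ le_Sup[OF G]] J_closed[OF j] G Sup_closed[OF G] by blast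
  qed
  have "high x \<preceq> \<Squnion>\<^bsub>lat_order A\<^esub>?G \<longleftrightarrow> x \<in> ?P" if x: "x \<in> J" for x
  proof
    assume "high x \<preceq> \<Squnion>\<^bsub>lat_order A\<^esub>?G"
    then consider y where "y \<in> ?P" "high x \<preceq> high y" | y where "y \<in> ?Q" "high x \<preceq> low y"
      using le_G[OF high_J[OF x]] by blast
    then show "x \<in> ?P"
    proof cases
      case (1 y)
      then have y: "y \<in> J" using PJ by blast
      have "low y \<preceq> low x"
        using g_antitone[OF high_J[OF x] high_J[OF y] 1(2)] g_high[OF x] g_high[OF y] by simp
      then show ?thesis using P_up[OF 1(1) x] by blast
    next
      \<comment> \<open>Antitonicity puts \<open>high y\<close> below \<open>low x\<close>, which is
        below \<open>low y\<close>; hence \<open>low y\<close> is fixed by \<open>g\<close> and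
        equals \<open>low x\<close>.\<close>
      case (2 y)
      then have y: "y \<in> J" using QJ by blast
      have c: "low x \<in> J" "high x \<in> J" "low y \<in> J" "high y \<in> J" using x y low_J high_J by auto
      have "high y \<preceq> low x"
        using g_antitone[OF c(2,3) 2(2)] g_high[OF x] by (simp add: high_def)
      moreover have "low x \<preceq> low y"
        using J_trans[OF low_le_high[OF x] 2(2)] c J_closed by blast
      ultimately have yx: "high y \<preceq> low y"
        using J_trans c J_closed by blast
      have yy: "high y = low y"
        using le_antisym'[OF yx low_le_high[OF y]] c J_closed by blast
      have "low x = low y"
        using le_antisym'[OF \<open>low x \<preceq> low y\<close>] \<open>high y \<preceq> low x\<close> yy c J_closed by simp
      \<comment> \<open>Every point seen from \<open>x\<close> or \<open>y\<close> is
        \<open>low y\<close>, so meeting \<open>X\<close> and being contained in \<open>X\<close>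
        coincide.\<close>
      have max: "z = low y" if z: "z \<in> J" "low y \<preceq> low z" for z
      proof -
        have "high z \<preceq> low y" using high_antitone[OF y z(1,2)] yy by simp
        moreover have "z \<preceq> high z" "low z \<preceq> z" using le_high low_le z by auto
        ultimately show ?thesis
          using z c low_J high_J J_closed J_trans le_antisym' by meson
      qed
      obtain z where z: "z \<in> X" "z \<in> J" "low y \<preceq> low z"
        using 2(1) unfolding upper_approx_def rel_def by blast
      then have "low y \<in> X" using max by blast
      then have "rel `` {x} \<subseteq> X"
        using max \<open>low x = low y\<close> unfolding rel_def by auto
      then show ?thesis using x by (simp add: lower_approx_def)
    qed
  next
    assume "x \<in> ?P"
    then show "high x \<preceq> \<Squnion>\<^bsub>lat_order A\<^esub>?G" using le_Sup[OF G] by blast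
  qed
  moreover have "low x \<preceq> \<Squnion>\<^bsub>lat_order A\<^esub>?G \<longleftrightarrow> x \<in> ?Q" if x: "x \<in> J" for x
  proof
    assume "low x \<preceq> \<Squnion>\<^bsub>lat_order A\<^esub>?G"
    then consider y where "y \<in> ?P" "low x \<preceq> high y" | y where "y \<in> ?Q" "low x \<preceq> low y"
      using le_G[OF low_J[OF x]] by blast
    then show "x \<in> ?Q"
    proof cases
      \<comment> \<open>Interpolation supplies a common successor \<open>k\<close> of
        \<open>x\<close> and \<open>y\<close>: it lies in the up-closed \<open>?P\<close>, hence in
        \<open>X\<close>, so \<open>x\<close> reaches \<open>X\<close>.\<close>
      case (1 y)
      then obtain k where "k \<in> J" "low x \<preceq> low k" "low y \<preceq> low k"
        using low_interpolation x PJ by blast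
      then show ?thesis using P_up[OF 1(1)] P_X X_Q Q_down x by blast
    next
      case (2 y)
      then show ?thesis using Q_down x by blast
    qed
  next
    assume "x \<in> ?Q"
    then show "low x \<preceq> \<Squnion>\<^bsub>lat_order A\<^esub>?G" using le_Sup[OF G] by blast
  qed
  ultimately have "rough (\<Squnion>\<^bsub>lat_order A\<^esub>?G) = (?P, ?Q)"
    using PJ QJ unfolding rough_def by blast
  then show ?thesis using Sup_closed[OF G] by blast
qed

text \<open>Residuation is tested on \<open>J\<close>, where primeness splits the join and
  \<open>i\<close> lies below \<open>neg A a\<close> exactly when \<open>g i\<close> is not below
  \<open>a\<close>.\<close>

lemma J_le_arrow_iff:
  assumes j: "j \<in> J" and a: "a \<in> carrier A" and b: "b \<in> carrier A"
  shows "j \<preceq> arrow A a b \<longleftrightarrow> (\<forall>i\<in>J. i \<preceq> j \<longrightarrow> i \<preceq> a \<longrightarrow> g i \<preceq> a \<longrightarrow> i \<preceq> b)"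
proof -
  have jc: "j \<in> carrier A" using j J_closed by blast
  have "j \<preceq> arrow A a b \<longleftrightarrow> (\<forall>i\<in>J. i \<preceq> wedge A a j \<longrightarrow> i \<preceq> vee A (neg A a) b)"
    using arrow_residual[OF a b jc] le_iff_J[of "wedge A a j" "vee A (neg A a) b"]
      a b jc wedge_closed vee_closed neg_closed by simp
  then show ?thesis
    using a b jc J_closed neg_closed by (auto simp: le_wedge_iff J_vee_iff J_le_neg_iff)
qed

text \<open>The right-hand side is membership of \<open>x\<close> in the lower coordinate of the
  arrow of rough sets. An \<open>i\<close> below \<open>high x\<close> need not be seen by
  \<open>x\<close>, so interpolation provides a common successor \<open>k\<close>.\<close>

lemma high_le_arrow_iff:
  assumes x: "x \<in> J" and a: "a \<in> carrier A" and b: "b \<in> carrier A"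
  shows "high x \<preceq> arrow A a b \<longleftrightarrow> (\<forall>y\<in>J. low x \<preceq> low y \<longrightarrow> high y \<preceq> a \<longrightarrow> high y \<preceq> b)"
  unfolding J_le_arrow_iff[OF high_J[OF x] a b]
proof (intro iffI ballI impI)
  fix y
  assume h: "\<forall>i\<in>J. i \<preceq> high x \<longrightarrow> i \<preceq> a \<longrightarrow> g i \<preceq> a \<longrightarrow> i \<preceq> b"
    and y: "y \<in> J" "low x \<preceq> low y" "high y \<preceq> a"
  have "g (high y) \<preceq> a"
    using J_trans[OF low_le_high y(3)] g_high y low_J high_J a by simp
  then show "high y \<preceq> b"
    using h high_J[OF y(1)] high_antitone[OF x y(1,2)] y(3) by blast
next
  fix i
  assume h: "\<forall>y\<in>J. low x \<preceq> low y \<longrightarrow> high y \<preceq> a \<longrightarrow> high y \<preceq> b"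
    and i: "i \<in> J" "i \<preceq> high x" "i \<preceq> a" "g i \<preceq> a"
  have ia: "high i \<preceq> a"
    using i g_g by (auto simp: high_def low_def)
  have "low i \<preceq> high x"
    using J_trans[OF low_le i(2)] i low_J high_J x J_closed by blast
  then obtain k where k: "k \<in> J" "low i \<preceq> low k" "low x \<preceq> low k"
    using low_interpolation i x by blast
  have "high k \<preceq> a"
    using J_trans[OF high_antitone[OF i(1) k(1,2)] ia] i k high_J a by blast
  then have kb: "high k \<preceq> b" using h k by blast
  \<comment> \<open>If \<open>i\<close> is the smaller member of its pair, it lies below
    \<open>high k\<close>; otherwise it is the larger one, \<open>x\<close> sees \<open>i\<close>,
    and the hypothesis applies to \<open>i\<close> itself.\<close>
  show "i \<preceq> b"
  proof (cases "i = low i")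
    case True
    then have "i \<preceq> high k"
      using J_trans[OF k(2) low_le_high] low_J high_J i k J_closed by auto
    then show ?thesis using J_trans kb i high_J k b by blast
  next
    case False
    then have "i = high i" using low_or_high i by blast
    then have "low x \<preceq> low i"
      using g_antitone[OF i(1) high_J[OF x] i(2)] g_high x i by metis
    then have "high i \<preceq> b" using h i ia by blast
    then show ?thesis using \<open>i = high i\<close> by simp
  qed
qed

text \<open>For \<open>i\<close> below \<open>low x\<close>, antitonicity puts \<open>high x\<close>
  below \<open>g i\<close>, so the premises already force \<open>high x\<close> below
  \<open>a\<close>; \<open>i = low x\<close> is the strongest instance.\<close>

lemma low_le_arrow_iff:
  assumes x: "x \<in> J" and a: "a \<in> carrier A" and b: "b \<in> carrier A"
  shows "low x \<preceq> arrow A a b \<longleftrightarrow> (high x \<preceq> a \<longrightarrow> low x \<preceq> b)"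
  unfolding J_le_arrow_iff[OF low_J[OF x] a b]
proof (intro iffI ballI impI)
  assume h: "\<forall>i\<in>J. i \<preceq> low x \<longrightarrow> i \<preceq> a \<longrightarrow> g i \<preceq> a \<longrightarrow> i \<preceq> b" and xa: "high x \<preceq> a"
  have "low x \<preceq> a" using J_trans[OF low_le_high xa] x low_J high_J a by blast
  then show "low x \<preceq> b"
    using h xa x low_J J_closed by (auto simp: high_def)
next
  fix i
  assume h: "high x \<preceq> a \<longrightarrow> low x \<preceq> b" and i: "i \<in> J" "i \<preceq> low x" "i \<preceq> a" "g i \<preceq> a"
  have "high x \<preceq> g i"
    using g_antitone[OF i(1) low_J[OF x] i(2)] by (simp add: high_def)
  then have "high x \<preceq> a"
    using J_trans i g_J high_J x a by blast
  then show "i \<preceq> b" using h J_trans[OF i(2)] i low_J x b by blast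
qed

lemma rough_iso: "nelson_iso A (IRS J rel) rough"
  unfolding nelson_iso_def
proof (intro conjI ballI)
  have "rough ` carrier A = carrier (IRS J rel)"
  proof
    show "rough ` carrier A \<subseteq> carrier (IRS J rel)"
      using rough_eq by (fastforce simp: IRS_def)
    show "carrier (IRS J rel) \<subseteq> rough ` carrier A"
    proof
      fix p assume "p \<in> carrier (IRS J rel)"
      then obtain X where "X \<subseteq> J" "p = (lower_approx J rel X, upper_approx J rel X)"
        by (auto simp: IRS_def)
      then show "p \<in> rough ` carrier A" using rough_surj[of X] by (metis imageI)
    qed
  qed
  then show "bij_betw rough (carrier A) (carrier (IRS J rel))"
    using rough_inj by (simp add: bij_betw_def)
next
  fix a b assume a: "a \<in> carrier A" and b: "b \<in> carrier A"
  show "rough (vee A a b) = vee (IRS J rel) (rough a) (rough b)"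
    using a b low_J high_J by (auto simp: rough_def IRS_def J_vee_iff)
  show "rough (wedge A a b) = wedge (IRS J rel) (rough a) (rough b)"
    using a b low_J high_J J_closed by (auto simp: rough_def IRS_def le_wedge_iff)
  show "rough (arrow A a b) = arrow (IRS J rel) (rough a) (rough b)"
    using a b by (auto simp: rough_def IRS_def lower_approx_def rel_def high_le_arrow_iff low_le_arrow_iff)
next
  fix a assume a: "a \<in> carrier A"
  show "rough (neg A a) = neg (IRS J rel) (rough a)"
    using a low_J high_J by (auto simp: rough_def IRS_def J_le_neg_iff g_high) (auto simp: high_def)
next
  show "rough (zero A) = zero (IRS J rel)"
    using J_not_le_zero low_J high_J by (auto simp: rough_def IRS_def)
  show "rough (one A) = one (IRS J rel)"
    using le_one low_J high_J J_closed by (auto simp: rough_def IRS_def)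
qed

text \<open>A fixed point \<open>k\<close> of \<open>g\<close> is its own \<open>low\<close> and
  \<open>high\<close>, and nothing else in \<open>J\<close> has a \<open>low\<close> above it, so it
  is a singleton point. Comparability in either direction puts \<open>low x\<close> below
  \<open>k\<close>, so \<open>x\<close> sees it.\<close>

lemma effective_rel:
  assumes fp: "\<forall>j\<in>J. \<exists>k\<in>J. g k = k \<and> (j \<preceq> k \<or> k \<preceq> j)"
  shows "effective_IRS J rel"
  unfolding effective_IRS_iff[OF preorder_rel]
proof
  fix x assume x: "x \<in> J"
  obtain k where k: "k \<in> J" "g k = k" "x \<preceq> k \<or> k \<preceq> x" using fp x by blast
  have lk: "low k = k" and hk: "high k = k" using k by (auto simp: low_def high_def)
  have "low x \<preceq> k"
    using k(3)
  proof
    assume "x \<preceq> k"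
    then show ?thesis using J_trans[OF low_le] x k low_J J_closed by blast
  next
    assume "k \<preceq> x"
    then have "k \<preceq> high x" using J_trans[OF _ le_high] x k high_J J_closed by blast
    then show ?thesis using g_antitone[OF k(1) high_J[OF x]] g_high[OF x] k(2) by simp
  qed
  moreover have "y = k" if y: "y \<in> J" "k \<preceq> low y" for y
  proof -
    have "high y \<preceq> k" using high_antitone[OF k(1) y(1)] y lk hk by simp
    then have "y \<preceq> k" using J_trans[OF le_high] y k high_J J_closed by blast
    moreover have "k \<preceq> y" using J_trans[OF y(2) low_le] y k low_J J_closed by blast
    ultimately show ?thesis using le_antisym' y k J_closed by blast
  qed
  then have "k \<in> singleton_points J rel"
    using k lk J_closed by (auto simp: singleton_points_def rel_def)
  ultimately show "\<exists>s\<in>singleton_points J rel. (x, s) \<in> rel"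
    using x k lk by (auto simp: rel_def)
qed

end

text \<open>A representing set lives in some type. \<open>J\<close> consists of elements of type
  \<open>'a\<close>, so the equivalence is stated there; the second conjunct adds necessity for sets
  over an arbitrary type \<open>'b\<close>.\<close>

theorem theorem4p11:
  fixes A :: "'a nelson"
  assumes "nelson_algebra A"
  defines "L \<equiv> lat_order A"
  defines "J \<equiv> comp_join_irr L"
  defines "cond \<equiv> algebraic_lattice L \<and>
      (\<forall>j\<in>J. \<exists>k\<in>J. g_map A k = k \<and> (j \<sqsubseteq>\<^bsub>L\<^esub> k \<or> k \<sqsubseteq>\<^bsub>L\<^esub> j))"
  shows "((\<exists>(U :: 'a set) R. preorder_on U R \<and> effective_IRS U R \<and> nelson_isomorphic A (IRS U R))
            \<longleftrightarrow> cond) \<and>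
         ((\<exists>(U :: 'b set) R. preorder_on U R \<and> effective_IRS U R \<and> nelson_isomorphic A (IRS U R))
            \<longrightarrow> cond)"
proof -
  interpret nelson_algebra A by fact
  \<comment> \<open>The type \<open>'c\<close> is generalised once this is proved and is then
    instantiated by both \<open>'a\<close> and \<open>'b\<close>.\<close>
  have necessary: cond
    if "preorder_on U R" "effective_IRS U R" "nelson_isomorphic A (IRS U R)"
    for U :: "'c set" and R
  proof -
    obtain f where "nelson_iso A (IRS U R) f"
      using \<open>nelson_isomorphic A (IRS U R)\<close> by (auto simp: nelson_isomorphic_def)
    then interpret effective_representation A U R f
      using that by unfold_locales
    show ?thesis
      unfolding cond_def J_def L_def using algebraic_lattice comparable_fixed_point by blast
  qed
  have sufficient: "\<exists>(U :: 'a set) R. preorder_on U R \<and> effective_IRS U R \<and> nelson_isomorphic A (IRS U R)"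
    if cond
  proof -
    interpret algebraic_nelson_algebra A
      using that by unfold_locales (simp add: cond_def L_def)
    show ?thesis
      using preorder_rel effective_rel rough_iso that
      unfolding cond_def J_def L_def nelson_isomorphic_def by blast
  qed
  show ?thesis
  proof (intro conjI iffI impI)
    show cond if "\<exists>(U :: 'a set) R. preorder_on U R \<and> effective_IRS U R \<and> nelson_isomorphic A (IRS U R)"
      using that by (elim exE conjE) (rule necessary)
    show cond if "\<exists>(U :: 'b set) R. preorder_on U R \<and> effective_IRS U R \<and> nelson_isomorphic A (IRS U R)"
      using that by (elim exE conjE) (rule necessary)
  qed (rule sufficient)
qed

end
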